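(* Let $m_{\mathcal{X}}(n)$ be the number of matroids on ground set $[n]$ having no minor isomorphic to $\mathcal{W}^3$ or $M(K_4)$, and let $s(n)$ be the number of sparse paving matroids on ground set $[n]$. Then $m_{\mathcal{X}}(n)=o(s(n))$ as $n\to\infty$.
   Context: A matroid is sparse paving if every nonspanning circuit is also a hyperplane. $\mathcal{W}^3$ is the rank-3 matroid on $\{a,b,c,d,e,f\}$ whose only dependent 3-sets are $\{a,b,c\},\{c,d,e\},\{e,f,a\}$; $M(K_4)$ (the cycle matroid of $K_4$) is the rank-3 matroid on $\{a,b,c,d,e,f\}$ whose only dependent 3-sets are $\{a,b,c\},\{c,d,e\},\{e,f,a\},\{b,d,f\}$. Matroids are counted as labelled matroids on $[n]$. *)

theory Defs
  imports Main "HOL-Library.Landau_Symbols"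
begin

definition matroid :: "'a set \<Rightarrow> 'a set set \<Rightarrow> bool" where
  "matroid E I \<longleftrightarrow> finite E \<and> I \<subseteq> Pow E \<and> {} \<in> I \<and>
     (\<forall>X Y. Y \<in> I \<and> X \<subseteq> Y \<longrightarrow> X \<in> I) \<and>
     (\<forall>X Y. X \<in> I \<and> Y \<in> I \<and> card X < card Y \<longrightarrow> (\<exists>y\<in>Y - X. insert y X \<in> I))"

definition mrank :: "'a set set \<Rightarrow> 'a set \<Rightarrow> nat" where
  "mrank I A = Max {card X | X. X \<subseteq> A \<and> X \<in> I}"

definition circuit :: "'a set \<Rightarrow> 'a set set \<Rightarrow> 'a set \<Rightarrow> bool" where
  "circuit E I C \<longleftrightarrow> C \<subseteq> E \<and> C \<notin> I \<and> (\<forall>x\<in>C. C - {x} \<in> I)"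

definition flat :: "'a set \<Rightarrow> 'a set set \<Rightarrow> 'a set \<Rightarrow> bool" where
  "flat E I F \<longleftrightarrow> F \<subseteq> E \<and> (\<forall>x\<in>E - F. mrank I (insert x F) > mrank I F)"

definition hyperplane :: "'a set \<Rightarrow> 'a set set \<Rightarrow> 'a set \<Rightarrow> bool" where
  "hyperplane E I H \<longleftrightarrow> flat E I H \<and> mrank I H + 1 = mrank I E"

definition sparse_paving :: "'a set \<Rightarrow> 'a set set \<Rightarrow> bool" where
  "sparse_paving E I \<longleftrightarrow> matroid E I \<and>
     (\<forall>C. circuit E I C \<and> mrank I C < mrank I E \<longrightarrow> hyperplane E I C)"

definition is_minor :: "'a set \<Rightarrow> 'a set set \<Rightarrow> 'a set \<Rightarrow> 'a set set \<Rightarrow> bool" where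
  "is_minor E' I' E I \<longleftrightarrow> (\<exists>C D. C \<subseteq> E \<and> D \<subseteq> E \<and> C \<inter> D = {} \<and> E' = E - (C \<union> D) \<and>
     I' = {X. X \<subseteq> E' \<and> (\<exists>B. B \<subseteq> C \<and> B \<in> I \<and> (\<forall>x\<in>C - B. insert x B \<notin> I) \<and> X \<union> B \<in> I)})"

definition matroid_iso :: "'a set \<Rightarrow> 'a set set \<Rightarrow> 'b set \<Rightarrow> 'b set set \<Rightarrow> bool" where
  "matroid_iso E I F J \<longleftrightarrow> (\<exists>f. bij_betw f E F \<and> (\<forall>X. X \<subseteq> E \<longrightarrow> (X \<in> I \<longleftrightarrow> f ` X \<in> J)))"

text \<open>Ground set {a,b,c,d,e,f} encoded as 0,1,2,3,4,5.\<close>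
definition W3_indep :: "nat set set" where
  "W3_indep = {X. X \<subseteq> {0..<6} \<and> card X \<le> 3 \<and> X \<notin> {{0,1,2},{2,3,4},{4,5,0}}}"

definition K4_indep :: "nat set set" where
  "K4_indep = {X. X \<subseteq> {0..<6} \<and> card X \<le> 3 \<and> X \<notin> {{0,1,2},{2,3,4},{4,5,0},{1,3,5}}}"

definition has_minor_iso :: "'a set \<Rightarrow> 'a set set \<Rightarrow> 'b set \<Rightarrow> 'b set set \<Rightarrow> bool" where
  "has_minor_iso E I F J \<longleftrightarrow> (\<exists>E' I'. is_minor E' I' E I \<and> matroid_iso E' I' F J)"

definition m_X :: "nat \<Rightarrow> nat" where
  "m_X n = card {I. matroid {1..n} I \<and>
      \<not> has_minor_iso {1..n} I {0..<6} W3_indep \<and> \<not> has_minor_iso {1..n} I {0..<6} K4_indep}"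

definition s_sp :: "nat \<Rightarrow> nat" where
  "s_sp n = card {I. sparse_paving {1..n} I}"

end

theory Submission
  imports Defs "HOL-Library.FuncSet"
begin

text \<open>
  Contracting an independent \<open>(r - 3)\<close>-set \<open>T\<close> of a rank-\<open>r\<close> matroid without either minor leaves a
  rank-3 matroid in which any three lines with at least three points that pairwise meet in distinct
  points coincide: otherwise the three meeting points and one further point on each line span
  \<open>W\<^sup>3\<close> or \<open>M(K\<^sub>4)\<close>. Shearer's inequality, applied to the sets of bases containing \<open>T\<close>, bounds the
  number of rank-\<open>r\<close> matroids by the number of such rank-3 matroids, so it suffices that there are
  only \<open>2 ^ o(m\<^sup>2)\<close> of these on \<open>m\<close> points.

  Such a rank-3 matroid is encoded by its loops, its parallel classes and a graph that follows
  each long line as a strip of triangles. Every edge of this graph lies in at least one and at most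
  four triangles, because all its triangles are collinear. By a Ruzsa--Szemeredi argument
  (energy increment) the graph has only \<open>o(m\<^sup>2)\<close> edges, which leaves \<open>2 ^ o(m\<^sup>2)\<close> choices. Altogether
  there are at most \<open>2 ^ o((n choose n/2) / n)\<close> matroids in the class, whereas the Graham--Sloane code gives at least
  \<open>2 ^ ((n choose n/2) / n)\<close> sparse paving matroids.
\<close>

subsection \<open>Shearer's inequality for set families\<close>

text \<open>Put \<open>M = n choose (n div 2)\<close> and \<open>k = n - r\<close>. The target
  exponent is \<open>M / n\<close>, and the reduction to rank 3 loses only a constant factor there:
  a bound \<open>exp (d * (k + 3) ^ 2)\<close> on the contractions becomes an exponent of about
  \<open>6 * d * (n choose r) / (k + 1)\<close>, which is of order \<open>d * M / n\<close>. So rank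
  3 needs a quadratic exponent with an arbitrarily small constant. Contracting once more would not
  do: in rank 2 the partitions into parallel classes alone give an exponent of order
  \<open>m * ln m\<close>, too large by a logarithm.

  The obstacle in rank 3 is that lines may be long. Replacing a line by a clique would put its edges
  into many triangles, while one triangle per line would forget its other points. A strip avoids
  both: each edge lies in few triangles, and consecutive triangles share two points, so together
  they still determine the line.

  The regularity lemma is bypassed: the only irregularity that matters comes from neighbourhoods of
  single vertices, so partitions by adjacency to a bounded vertex set suffice. Ranks below 3 or
  within a constant of \<open>n\<close> are left to the trivial bound
  \<open>2 ^ (n choose r)\<close>, whose exponent is polynomial in \<open>n\<close>.\<close>

lemma ln_sum_ge:
  fixes a b t :: real
  assumes "0 < a" "0 < b" "0 < t" "t < 1"
  shows "t * ln (a / t) + (1 - t) * ln (b / (1 - t)) \<le> ln (a + b)"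
proof -
  \<comment> \<open>The tangent of \<open>ln\<close> at \<open>a + b\<close>. The weighted sum of
    the two arguments \<open>a / t\<close> and \<open>b / (1 - t)\<close> is \<open>a + b\<close>,
    so the linear terms cancel below: this is Jensen's inequality.\<close>
  have *: "ln u \<le> ln (a + b) + (u / (a + b) - 1)" if "0 < u" for u
    using ln_le_minus_one[of "u / (a + b)"] that assms by (simp add: ln_div)
  have "t * ln (a / t) + (1 - t) * ln (b / (1 - t))
      \<le> t * (ln (a + b) + (a / t / (a + b) - 1)) + (1 - t) * (ln (a + b) + (b / (1 - t) / (a + b) - 1))"
    using assms by (intro add_mono mult_left_mono *) auto
  also have "\<dots> = ln (a + b) + (a / (a + b) + b / (a + b) - 1)"
  proof -
    have "t * (a / t / (a + b) - 1) = a / (a + b) - t" "(1 - t) * (b / (1 - t) / (a + b) - 1) = b / (a + b) - (1 - t)"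
      using assms by (simp_all add: right_diff_distrib)
    then show ?thesis by (simp only: distrib_left) (simp add: algebra_simps)
  qed
  also have "a / (a + b) + b / (a + b) = 1" using assms by (simp flip: add_divide_distrib)
  finally show ?thesis by simp
qed

text \<open>Hoelder's inequality for two summands, proved by taking logarithms and applying
  concavity to each factor. The weight \<open>t = x / (x + y)\<close> makes \<open>x / t\<close> and
  \<open>y / (1 - t)\<close> both equal to \<open>x + y\<close>. In the induction for Shearer's
  inequality, \<open>p\<close> collects the factors unaffected by the element being removed.\<close>

lemma power_add_le_prod_add:
  fixes x y p :: real and a b :: "'i \<Rightarrow> real"
  assumes "finite J" "0 \<le> x" "0 \<le> y" "0 \<le> p"
    and nonneg: "\<And>j. j \<in> J \<Longrightarrow> 0 \<le> a j" "\<And>j. j \<in> J \<Longrightarrow> 0 \<le> b j"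
    and x: "x ^ card J \<le> p * (\<Prod>j\<in>J. a j)" and y: "y ^ card J \<le> p * (\<Prod>j\<in>J. b j)"
  shows "(x + y) ^ card J \<le> p * (\<Prod>j\<in>J. a j + b j)"
proof (cases "x = 0 \<or> y = 0")
  case True
  have "p * (\<Prod>j\<in>J. a j) \<le> p * (\<Prod>j\<in>J. a j + b j)" "p * (\<Prod>j\<in>J. b j) \<le> p * (\<Prod>j\<in>J. a j + b j)"
    using assms by (auto intro!: mult_left_mono prod_mono)
  then show ?thesis using True x y by auto
next
  case False
  let ?d = "card J"
  define t where "t = x / (x + y)"
  have xy: "0 < x" "0 < y" using False assms by auto
  then have "0 < p * prod a J" "0 < p * prod b J"
    using x y by (meson zero_less_power less_le_trans)+
  then have "0 < p" "0 < prod a J" "0 < prod b J"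
    using assms by (auto simp: zero_less_mult_iff prod_nonneg not_less[symmetric])
  then have pos: "0 < a j" "0 < b j" if "j \<in> J" for j
    using that nonneg \<open>finite J\<close> by (auto simp: less_le)
  have t: "0 < t" "t < 1" "1 - t = y / (x + y)" using xy by (auto simp: t_def field_simps)
  have s: "ln x - ln t = ln (x + y)" "ln y - ln (1 - t) = ln (x + y)"
    using xy by (simp_all add: t(3)) (simp_all add: t_def ln_div)
  have lx: "?d * ln x \<le> ln p + (\<Sum>j\<in>J. ln (a j))" and ly: "?d * ln y \<le> ln p + (\<Sum>j\<in>J. ln (b j))"
  proof -
    have "ln (x ^ ?d) \<le> ln (p * prod a J)" "ln (y ^ ?d) \<le> ln (p * prod b J)"
      using x y xy by (auto intro!: ln_mono)
    then have "?d * ln x \<le> ln p + ln (prod a J)" "?d * ln y \<le> ln p + ln (prod b J)"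
      using \<open>0 < p\<close> \<open>0 < prod a J\<close> \<open>0 < prod b J\<close> xy by (simp_all only: ln_realpow ln_mult_pos)
    then show "?d * ln x \<le> ln p + (\<Sum>j\<in>J. ln (a j))" "?d * ln y \<le> ln p + (\<Sum>j\<in>J. ln (b j))"
      using ln_prod[OF \<open>finite J\<close>, of a] ln_prod[OF \<open>finite J\<close>, of b] pos
      by (metis less_irrefl)+
  qed
  have "?d * ln (x + y) = t * (?d * ln x - ?d * ln t) + (1 - t) * (?d * ln y - ?d * ln (1 - t))"
    by (simp only: right_diff_distrib[symmetric] s) (simp add: algebra_simps)
  also have "\<dots> \<le> t * (ln p + (\<Sum>j\<in>J. ln (a j)) - ?d * ln t)
      + (1 - t) * (ln p + (\<Sum>j\<in>J. ln (b j)) - ?d * ln (1 - t))"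
    using lx ly t by (intro add_mono mult_left_mono diff_right_mono) auto
  also have "\<dots> = ln p + (\<Sum>j\<in>J. t * ln (a j / t) + (1 - t) * ln (b j / (1 - t)))"
  proof -
    have "(\<Sum>j\<in>J. t * ln (a j / t) + (1 - t) * ln (b j / (1 - t)))
        = (\<Sum>j\<in>J. t * (ln (a j) - ln t) + (1 - t) * (ln (b j) - ln (1 - t)))"
      using pos t(1,2) by (intro sum.cong refl) (simp add: ln_divide_pos)
    also have "\<dots> = t * ((\<Sum>j\<in>J. ln (a j)) - ?d * ln t) + (1 - t) * ((\<Sum>j\<in>J. ln (b j)) - ?d * ln (1 - t))"
      by (simp only: sum.distrib sum_distrib_left[symmetric] sum_subtractf sum_constant)
    finally show ?thesis by (simp add: algebra_simps)
  qed
  also have "\<dots> \<le> ln p + (\<Sum>j\<in>J. ln (a j + b j))"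
    using pos t by (intro add_left_mono sum_mono ln_sum_ge) auto
  also have "\<dots> = ln (p * (\<Prod>j\<in>J. a j + b j))"
  proof -
    have ab: "a j + b j \<noteq> 0" if "j \<in> J" for j using add_pos_pos[OF pos(1,2)] that by force
    then have "ln (\<Prod>j\<in>J. a j + b j) = (\<Sum>j\<in>J. ln (a j + b j))" using \<open>finite J\<close> by (rule ln_prod[rotated])
    then show ?thesis using \<open>0 < p\<close> \<open>finite J\<close> ab by (simp add: ln_mult)
  qed
  finally have "ln ((x + y) ^ ?d) \<le> ln (p * (\<Prod>j\<in>J. a j + b j))"
    using xy by (simp add: ln_realpow)
  moreover have "0 < p * (\<Prod>j\<in>J. a j + b j)"
    using pos \<open>0 < p\<close> by (auto intro!: mult_pos_pos prod_pos add_pos_pos)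
  ultimately show ?thesis using xy by (simp add: add_pos_pos)
qed

text \<open>Induction on the ground set instead of entropy. Removing \<open>v\<close> splits the
  family into the members without \<open>v\<close> and those with \<open>v\<close>, the latter with
  \<open>v\<close> deleted. For the \<open>d\<close> indices with \<open>v\<close> in
  \<open>F j\<close> the trace counts of the two parts add up; for the others each part has at most
  as many traces as the whole. Hoelder then recombines the two induction hypotheses.\<close>

theorem shearer_set_family:
  fixes F :: "'i \<Rightarrow> 'a set"
  assumes "finite V" "finite J" "0 < d" "\<A> \<subseteq> Pow V"
    and "\<And>v. v \<in> V \<Longrightarrow> card {j \<in> J. v \<in> F j} = d"
  shows "real (card \<A>) ^ d \<le> (\<Prod>j\<in>J. real (card ((\<lambda>A. A \<inter> F j) ` \<A>)))"
  using assms(1,4,5)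
proof (induction V arbitrary: \<A> rule: finite_induct)
  case empty
  then consider "\<A> = {}" | "\<A> = {{}}" by auto
  then show ?case using \<open>0 < d\<close> by cases (auto simp: power_0_left)
next
  case (insert v V)
  define A0 where "A0 = {A \<in> \<A>. v \<notin> A}"
  define A1 where "A1 = (\<lambda>A. A - {v}) ` {A \<in> \<A>. v \<in> A}"
  define c where "c \<A> j = real (card ((\<lambda>A. A \<inter> F j) ` \<A>))" for \<A> j
  have finA: "finite \<A>" using insert.prems(1) insert.hyps(1) by (auto intro: finite_subset)
  let ?J = "{j \<in> J. v \<in> F j}" and ?J' = "{j \<in> J. v \<notin> F j}"
  have J: "J = ?J \<union> ?J'" "?J \<inter> ?J' = {}" by auto
  have split: "(\<Prod>j\<in>J. h j) = (\<Prod>j\<in>?J'. h j) * (\<Prod>j\<in>?J. h j)" for h :: "'i \<Rightarrow> real"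
    using \<open>finite J\<close> by (subst J(1), subst prod.union_disjoint) auto
  have IH0: "real (card A0) ^ d \<le> (\<Prod>j\<in>J. c A0 j)" and IH1: "real (card A1) ^ d \<le> (\<Prod>j\<in>J. c A1 j)"
    unfolding c_def using insert.prems by (intro insert.IH; force simp: A0_def A1_def)+
  have inj1: "inj_on (\<lambda>A. A - {v}) {A \<in> \<A>. v \<in> A}" by (rule inj_onI) blast
  have "card \<A> = card A0 + card {A \<in> \<A>. v \<in> A}"
    unfolding A0_def using finA by (subst card_Un_disjoint[symmetric]) (auto intro!: arg_cong[where f = card])
  then have cardA: "real (card \<A>) = card A0 + card A1" using inj1 by (simp add: A1_def card_image)
  have le0: "c A0 j \<le> c \<A> j" for j
    unfolding c_def using finA by (intro of_nat_mono card_mono) (auto simp: A0_def)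
  have le1: "c A1 j \<le> c \<A> j" if "v \<notin> F j" for j
    unfolding c_def using finA that by (intro of_nat_mono card_mono) (auto simp: A1_def image_iff)
  have sum: "c A0 j + c A1 j \<le> c \<A> j" if "v \<in> F j" for j
  proof -
    let ?T0 = "(\<lambda>A. A \<inter> F j) ` A0" and ?T1 = "(\<lambda>A. A \<inter> F j) ` A1"
    have "card ?T1 = card (Set.insert v ` ?T1)"
      by (rule card_image[symmetric], rule inj_onI) (auto simp: A1_def)
    moreover have "finite ?T0" "finite ?T1" using finA by (auto simp: A0_def A1_def)
    ultimately have "card ?T0 + card ?T1 = card (?T0 \<union> Set.insert v ` ?T1)"
      by (subst card_Un_disjoint) (auto simp: A0_def)
    also have "\<dots> \<le> card ((\<lambda>A. A \<inter> F j) ` \<A>)"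
    proof (rule card_mono)
      have "Set.insert v ((A - {v}) \<inter> F j) = A \<inter> F j" if "v \<in> A" for A
        using that \<open>v \<in> F j\<close> by auto
      then show "?T0 \<union> Set.insert v ` ?T1 \<subseteq> (\<lambda>A. A \<inter> F j) ` \<A>"
        by (auto simp: A0_def A1_def image_iff)
    qed (use finA in auto)
    finally show ?thesis by (simp add: c_def flip: of_nat_add)
  qed
  let ?p = "\<Prod>j\<in>?J'. c \<A> j"
  have cardJ: "card ?J = d" using insert.prems(2) by auto
  have c0: "0 \<le> c \<A> j" for \<A> j by (simp add: c_def)
  have "(real (card A0) + real (card A1)) ^ card ?J \<le> ?p * (\<Prod>j\<in>?J. c A0 j + c A1 j)"
  proof (rule power_add_le_prod_add)
    have "(\<Prod>j\<in>?J'. c A0 j) * (\<Prod>j\<in>?J. c A0 j) \<le> ?p * (\<Prod>j\<in>?J. c A0 j)"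
      by (intro mult_right_mono prod_mono prod_nonneg) (auto simp: c0 le0)
    then show "real (card A0) ^ card ?J \<le> ?p * (\<Prod>j\<in>?J. c A0 j)"
      using IH0 by (simp add: cardJ split)
    have "(\<Prod>j\<in>?J'. c A1 j) * (\<Prod>j\<in>?J. c A1 j) \<le> ?p * (\<Prod>j\<in>?J. c A1 j)"
      by (intro mult_right_mono prod_mono prod_nonneg) (auto simp: c0 le1)
    then show "real (card A1) ^ card ?J \<le> ?p * (\<Prod>j\<in>?J. c A1 j)"
      using IH1 by (simp add: cardJ split)
  qed (use \<open>finite J\<close> in \<open>auto simp: c0 intro: prod_nonneg\<close>)
  also have "\<dots> \<le> ?p * (\<Prod>j\<in>?J. c \<A> j)"
    by (intro mult_left_mono prod_mono prod_nonneg) (auto simp: c0 sum)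
  also have "\<dots> = (\<Prod>j\<in>J. c \<A> j)" by (simp add: split)
  finally show ?case by (simp add: cardA cardJ c_def)
qed

subsection \<open>Graphs whose edges lie in few triangles\<close>

text \<open>The conditional expectation of \<open>f\<close> with respect to the partition of
  \<open>P\<close> into level sets of \<open>l\<close>. A partition is given by a labelling so that
  refinement is an implication between equalities of labels; \<open>energy\<close> below is the
  squared norm of this projection, without normalisation.\<close>

definition block_avg :: "'a set \<Rightarrow> ('a \<Rightarrow> 'b) \<Rightarrow> ('a \<Rightarrow> real) \<Rightarrow> 'a \<Rightarrow> real" where
  "block_avg P l f p = (\<Sum>q | q \<in> P \<and> l q = l p. f q) / card {q \<in> P. l q = l p}"

definition energy :: "'a set \<Rightarrow> ('a \<Rightarrow> 'b) \<Rightarrow> ('a \<Rightarrow> real) \<Rightarrow> real" where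
  "energy P l f = (\<Sum>p\<in>P. (block_avg P l f p)\<^sup>2)"

lemma block_avg_cong: "l p = l q \<Longrightarrow> block_avg P l f p = block_avg P l f q"
  by (simp add: block_avg_def)

text \<open>The characteristic property of conditional expectation: against functions constant on
  the classes, \<open>f\<close> and its average are indistinguishable.\<close>

lemma sum_block_avg_mult:
  assumes "finite P" and inv: "\<And>p q. p \<in> P \<Longrightarrow> q \<in> P \<Longrightarrow> l p = l q \<Longrightarrow> h p = h q"
  shows "(\<Sum>p\<in>P. block_avg P l f p * h p) = (\<Sum>p\<in>P. f p * h p)"
proof -
  have eq: "(\<Sum>p | p \<in> P \<and> l p = b. block_avg P l f p * h p) = (\<Sum>p | p \<in> P \<and> l p = b. f p * h p)"
    if "b \<in> l ` P" for b
  proof -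
    obtain p0 where p0: "p0 \<in> P" "l p0 = b" using \<open>b \<in> l ` P\<close> by auto
    let ?B = "{p \<in> P. l p = b}"
    have "card ?B > 0" using p0 assms(1) by (auto simp: card_gt_0_iff)
    have "(\<Sum>p\<in>?B. block_avg P l f p * h p) = (\<Sum>p\<in>?B. ((\<Sum>q\<in>?B. f q) / card ?B) * h p0)"
      using p0 by (intro sum.cong refl) (auto simp: block_avg_def intro: inv)
    also have "\<dots> = (\<Sum>q\<in>?B. f q) * h p0" using \<open>card ?B > 0\<close> by simp
    also have "\<dots> = (\<Sum>p\<in>?B. f p * h p)"
      unfolding sum_distrib_right using p0 by (intro sum.cong refl) (auto intro: inv)
    finally show ?thesis .
  qed
  have "(\<Sum>b\<in>l`P. \<Sum>p | p \<in> P \<and> l p = b. block_avg P l f p * h p)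
           = (\<Sum>b\<in>l`P. \<Sum>p | p \<in> P \<and> l p = b. f p * h p)"
    by (rule sum.cong[OF refl eq])
  then show ?thesis
    using sum.group[OF assms(1), of "l ` P" l "\<lambda>p. block_avg P l f p * h p"]
      sum.group[OF assms(1), of "l ` P" l "\<lambda>p. f p * h p"] assms(1) by simp
qed

lemma sum_block_avg: "finite P \<Longrightarrow> (\<Sum>p\<in>P. block_avg P l f p) = (\<Sum>p\<in>P. f p)"
  using sum_block_avg_mult[of P l "\<lambda>_. 1" f] by simp

lemma block_avg_nonneg: "(\<And>q. q \<in> P \<Longrightarrow> 0 \<le> f q) \<Longrightarrow> 0 \<le> block_avg P l f p"
  unfolding block_avg_def by (intro divide_nonneg_nonneg sum_nonneg) auto

lemma block_avg_le_1:
  assumes "\<And>q. q \<in> P \<Longrightarrow> f q \<le> 1" shows "block_avg P l f p \<le> 1"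
proof -
  have "(\<Sum>q | q \<in> P \<and> l q = l p. f q) \<le> real (card {q \<in> P. l q = l p}) * 1"
    by (rule sum_bounded_above) (use assms in auto)
  then show ?thesis unfolding block_avg_def
    by (cases "card {q \<in> P. l q = l p} = 0") (simp_all only: divide_le_eq_1, auto)
qed

lemma energy_le_card:
  assumes "\<And>q. q \<in> P \<Longrightarrow> 0 \<le> f q" "\<And>q. q \<in> P \<Longrightarrow> f q \<le> 1"
  shows "energy P l f \<le> card P"
proof -
  have "energy P l f \<le> (\<Sum>p\<in>P. 1)" unfolding energy_def
    using block_avg_nonneg[of P f l] block_avg_le_1[of P f l] assms
    by (intro sum_mono) (simp add: power_le_one)
  then show ?thesis by simp
qed

lemma energy_nonneg: "0 \<le> energy P l f"
  unfolding energy_def by (intro sum_nonneg) auto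

text \<open>Pythagoras: the coarse average is the projection of the fine one, so the mixed term
  equals the coarse energy.\<close>

lemma energy_refine:
  assumes "finite P" and ref: "\<And>p q. p \<in> P \<Longrightarrow> q \<in> P \<Longrightarrow> l' p = l' q \<Longrightarrow> l p = l q"
  shows "(\<Sum>p\<in>P. (block_avg P l' f p - block_avg P l f p)\<^sup>2) = energy P l' f - energy P l f"
proof -
  let ?a = "block_avg P l f" and ?a' = "block_avg P l' f"
  have "(\<Sum>p\<in>P. ?a' p * ?a p) = (\<Sum>p\<in>P. f p * ?a p)"
    by (rule sum_block_avg_mult[OF assms(1)]) (metis block_avg_cong ref)
  moreover have "(\<Sum>p\<in>P. ?a p * ?a p) = (\<Sum>p\<in>P. f p * ?a p)"
    by (rule sum_block_avg_mult[OF assms(1)]) (metis block_avg_cong)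
  moreover have "(\<Sum>p\<in>P. (?a' p - ?a p)\<^sup>2)
      = (\<Sum>p\<in>P. (?a' p)\<^sup>2) - 2 * (\<Sum>p\<in>P. ?a' p * ?a p) + (\<Sum>p\<in>P. ?a p * ?a p)"
    unfolding sum_distrib_left sum.distrib[symmetric] sum_subtractf[symmetric]
    by (intro sum.cong refl) (simp add: power2_eq_square algebra_simps)
  ultimately show ?thesis unfolding energy_def by (simp add: power2_eq_square)
qed

text \<open>Being in a low block is constant on classes, so \<open>f\<close> may be replaced by its
  average, which is below \<open>e\<close> there. This does the cleaning both for pairs of vertices
  and for single vertices.\<close>

lemma sum_low_blocks_le:
  assumes "finite P" "\<And>q. q \<in> P \<Longrightarrow> 0 \<le> f q" "0 \<le> e"
  shows "(\<Sum>p | p \<in> P \<and> block_avg P l f p < e. f p) \<le> e * card P"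
proof -
  have "(\<Sum>p | p \<in> P \<and> block_avg P l f p < e. f p)
      = (\<Sum>p\<in>P. f p * of_bool (block_avg P l f p < e))"
    by (rule sum.mono_neutral_cong_left) (use assms in auto)
  also have "\<dots> = (\<Sum>p\<in>P. block_avg P l f p * of_bool (block_avg P l f p < e))"
    by (rule sum_block_avg_mult[symmetric, OF assms(1)]) (metis block_avg_cong)
  also have "\<dots> \<le> (\<Sum>p\<in>P. e)" by (rule sum_mono) (use assms(3) in auto)
  finally show ?thesis by (simp add: mult.commute)
qed

text \<open>Each point of \<open>B\<close> has in its class a witness \<open>W\<close> of proportion
  at least \<open>k\<close>, a union of finer classes, on which the mean drops by \<open>t\<close>.
  So the squared change of the average has mean at least \<open>k * t\<^sup>2\<close> on that class.
  Summing these class means over \<open>B\<close>, rather than the changes themselves, lets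
  \<open>B\<close> be any set of points, and over all of \<open>P\<close> they add up to the energy
  difference.\<close>

lemma energy_increment:
  fixes t k :: real
  assumes fin: "finite P" and ref: "\<And>p q. p \<in> P \<Longrightarrow> q \<in> P \<Longrightarrow> l' p = l' q \<Longrightarrow> l p = l q"
    and "B \<subseteq> P" "0 \<le> t" "0 \<le> k"
    and W: "\<And>p. p \<in> B \<Longrightarrow> \<exists>W \<subseteq> {q \<in> P. l q = l p}.
        (\<forall>q\<in>W. \<forall>q'\<in>P. l' q' = l' q \<longrightarrow> q' \<in> W) \<and>
        k * card {q \<in> P. l q = l p} \<le> card W \<and> (\<Sum>q\<in>W. f q) \<le> (block_avg P l f p - t) * card W"
  shows "card B * (k * t\<^sup>2) \<le> energy P l' f - energy P l f"
proof -
  define d where "d p = block_avg P l' f p - block_avg P l f p" for p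
  have "k * t\<^sup>2 \<le> block_avg P l (\<lambda>p. (d p)\<^sup>2) p" if "p \<in> B" for p
  proof -
    let ?C = "{q \<in> P. l q = l p}"
    have C0: "card ?C > 0" using that \<open>B \<subseteq> P\<close> fin by (auto simp: card_gt_0_iff)
    obtain W where W: "W \<subseteq> ?C" "\<And>q q'. q \<in> W \<Longrightarrow> q' \<in> P \<Longrightarrow> l' q' = l' q \<Longrightarrow> q' \<in> W"
      "k * card ?C \<le> card W" "(\<Sum>q\<in>W. f q) \<le> (block_avg P l f p - t) * card W"
      using W[OF \<open>p \<in> B\<close>] by blast
    have finC: "finite ?C" using fin by simp
    have WP: "P \<inter> W = W" using W(1) by blast
    have "(\<Sum>q\<in>P. block_avg P l' f q * of_bool (q \<in> W)) = (\<Sum>q\<in>P. f q * of_bool (q \<in> W))"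
    proof (rule sum_block_avg_mult[OF fin])
      fix q q' assume "q \<in> P" "q' \<in> P" "l' q = l' q'"
      then show "of_bool (q \<in> W) = (of_bool (q' \<in> W) :: real)"
        using W(2)[of q q'] W(2)[of q' q] by auto
    qed
    then have "(\<Sum>q\<in>W. block_avg P l' f q) = (\<Sum>q\<in>W. f q)"
      using fin WP by (simp add: of_bool_def if_distrib sum.If_cases cong: if_cong)
    moreover have "(\<Sum>q\<in>W. block_avg P l f q) = (\<Sum>q\<in>W. block_avg P l f p)"
      using W(1) by (intro sum.cong refl block_avg_cong) auto
    ultimately have dW: "(\<Sum>q\<in>W. d q) \<le> - t * card W"
      using W(4) unfolding d_def by (simp add: sum_subtractf algebra_simps)
    have "t\<^sup>2 * (k * card ?C) \<le> t\<^sup>2 * card W" by (intro mult_left_mono W(3)) auto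
    also have "\<dots> = - 2 * t * (- t * card W) - t\<^sup>2 * card W" by (simp add: power2_eq_square)
    also have "\<dots> \<le> - 2 * t * (\<Sum>q\<in>W. d q) - t\<^sup>2 * card W"
      using dW \<open>0 \<le> t\<close> by (intro diff_right_mono mult_left_mono_neg) auto
    also have "\<dots> = (\<Sum>q\<in>W. - 2 * t * d q - t\<^sup>2)"
      unfolding sum_subtractf sum_distrib_left by simp
    \<comment> \<open>The tangent of the square at \<open>- t\<close>, used in place of the
      Cauchy-Schwarz inequality.\<close>
    also have "\<dots> \<le> (\<Sum>q\<in>W. (d q)\<^sup>2)"
    proof (rule sum_mono)
      fix q show "- 2 * t * d q - t\<^sup>2 \<le> (d q)\<^sup>2"
        using zero_le_power2[of "d q + t"] by (simp add: power2_sum algebra_simps)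
    qed
    also have "\<dots> \<le> (\<Sum>q\<in>?C. (d q)\<^sup>2)" using finC W(1) by (intro sum_mono2) auto
    finally show ?thesis unfolding block_avg_def using C0 by (simp add: field_simps)
  qed
  then have "(\<Sum>p\<in>B. k * t\<^sup>2) \<le> (\<Sum>p\<in>B. block_avg P l (\<lambda>p. (d p)\<^sup>2) p)" by (rule sum_mono)
  also have "\<dots> \<le> (\<Sum>p\<in>P. block_avg P l (\<lambda>p. (d p)\<^sup>2) p)"
    using fin \<open>B \<subseteq> P\<close> by (intro sum_mono2 block_avg_nonneg) auto
  also have "\<dots> = (\<Sum>p\<in>P. (d p)\<^sup>2)" by (rule sum_block_avg[OF fin])
  also have "\<dots> = energy P l' f - energy P l f" unfolding d_def using fin ref by (rule energy_refine)
  finally show ?thesis by simp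
qed

section \<open>Partitions by adjacency to a small vertex set\<close>

definition nbrs :: "('a \<times> 'a) set \<Rightarrow> 'a set \<Rightarrow> 'a \<Rightarrow> 'a set" where
  "nbrs E Z x = {z \<in> Z. (x, z) \<in> E}"

lemma nbrs_mono_eq: "Z \<subseteq> Z' \<Longrightarrow> nbrs E Z' x = nbrs E Z' y \<Longrightarrow> nbrs E Z x = nbrs E Z y"
  unfolding nbrs_def by blast

lemma nbrs_eqD: "nbrs E Z x = nbrs E Z y \<Longrightarrow> z \<in> Z \<Longrightarrow> (x, z) \<in> E \<longleftrightarrow> (y, z) \<in> E"
  unfolding nbrs_def by blast

lemma card_small_nbrs_classes:
  fixes m :: real
  assumes "finite V" "finite Z" "0 \<le> m"
  shows "card {x \<in> V. card {x' \<in> V. nbrs E Z x' = nbrs E Z x} < m} \<le> 2 ^ card Z * m"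
proof -
  let ?l = "nbrs E Z" and ?S = "{x \<in> V. card {x' \<in> V. nbrs E Z x' = nbrs E Z x} < m}"
  have "card (?l ` ?S) \<le> card (Pow Z)"
    by (rule card_mono) (use assms in \<open>auto simp: nbrs_def\<close>)
  then have labels: "card (?l ` ?S) \<le> 2 ^ card Z" by (simp add: card_Pow assms)
  have "card {x \<in> ?S. ?l x = b} \<le> m" if "b \<in> ?l ` ?S" for b
  proof -
    obtain x where x: "x \<in> ?S" "?l x = b" using \<open>b \<in> _\<close> by blast
    have "card {x \<in> ?S. ?l x = b} \<le> card {x' \<in> V. ?l x' = ?l x}"
      by (rule card_mono) (use assms(1) x in auto)
    with x show ?thesis by simp
  qed
  then have le: "(\<Sum>b\<in>?l ` ?S. real (card {x \<in> ?S. ?l x = b})) \<le> card (?l ` ?S) * m"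
    by (intro sum_bounded_above) auto
  have "real (card ?S) = (\<Sum>b\<in>?l ` ?S. real (card {x \<in> ?S. ?l x = b}))"
    using sum.group[of ?S "?l ` ?S" ?l "\<lambda>_. 1::real"] assms(1) by simp
  also note le
  also have "card (?l ` ?S) * m \<le> 2 ^ card Z * m"
    using labels assms(3) by (intro mult_right_mono) (simp_all flip: of_nat_power)
  finally show ?thesis .
qed

text \<open>The vertices added to \<open>Z\<close> are apexes \<open>z\<close> whose neighbourhood contains a large part of both
  classes of a dense pair. The graph induced on the neighbourhood of \<open>z\<close> has maximum degree at most
  \<open>D\<close>, so these parts span almost no edges and witness the irregularity of the pair.\<close>
lemma triangle_energy_step:
  fixes V :: "'a set" and e :: real and D k :: nat
  assumes fin: "finite V" and EV: "E \<subseteq> V \<times> V" and "sym E"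
    and tri: "\<And>x y. (x, y) \<in> E \<Longrightarrow> \<exists>z. (x, z) \<in> E \<and> (y, z) \<in> E"
    and codeg: "\<And>x z. (x, z) \<in> E \<Longrightarrow> card {y. (x, y) \<in> E \<and> (y, z) \<in> E} \<le> D"
    and e: "0 < e" and Z: "Z \<subseteq> V" "card Z \<le> k"
    and large: "2 * D * 2 ^ k \<le> e ^ 3 * card V"
    and many: "(4 + 2 * D) * e * (card V)\<^sup>2 < card E"
  shows "\<exists>Z' \<subseteq> V. card Z' \<le> k + 4 ^ k \<and>
    energy (V \<times> V) (map_prod (nbrs E Z) (nbrs E Z)) (\<lambda>p. of_bool (p \<in> E)) + e ^ 5 / 4 * (card V)\<^sup>2
    \<le> energy (V \<times> V) (map_prod (nbrs E Z') (nbrs E Z')) (\<lambda>p. of_bool (p \<in> E))"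
proof -
  define n where "n = real (card V)"
  define P where "P = V \<times> V"
  define f :: "'a \<times> 'a \<Rightarrow> real" where "f = (\<lambda>p. of_bool (p \<in> E))"
  define l where "l = map_prod (nbrs E Z) (nbrs E Z)"
  define c where "c x = {x' \<in> V. nbrs E Z x' = nbrs E Z x}" for x
  define N where "N z = {x. (x, z) \<in> E}" for z
  \<comment> \<open>The threshold for small classes: there are at most \<open>2 ^ k\<close> classes,
    so those smaller than \<open>m\<close> contain at most \<open>2 ^ k * m = e * n\<close> vertices
    in total.\<close>
  define m where "m = e / 2 ^ k * n"
  have finP: "finite P" and finE: "finite E" and finZ: "finite Z"
    using fin EV Z(1) by (auto simp: P_def intro: finite_subset)
  have cardP: "real (card P) = n\<^sup>2" by (simp add: P_def n_def card_cartesian_product power2_eq_square)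
  have NV: "N z \<subseteq> V" for z using EV by (auto simp: N_def)
  have block: "{q \<in> P. l q = l (x, y)} = c x \<times> c y" for x y
    by (auto simp: P_def l_def c_def)
  have finc: "finite (c x)" for x using fin by (simp add: c_def)
  have finG: "finite {y. (x, y) \<in> E \<and> (y, z) \<in> E}" for x z
    by (rule finite_subset[OF _ fin]) (use EV in auto)
  have n0: "0 \<le> n" "0 \<le> m" using e by (simp_all add: n_def m_def)
  \<comment> \<open>The vertex \<open>z\<close> witnesses that the dense pair of classes of
    \<open>p\<close> is irregular. The condition depends on \<open>p\<close> only through its two
    classes; this later allows one choice of \<open>z\<close> for the whole pair.\<close>
  define good where "good z p \<longleftrightarrow> e \<le> block_avg P l f p \<and>
      e * card (c (fst p)) \<le> card (N z \<inter> c (fst p)) \<and> e * card (c (snd p)) \<le> card (N z \<inter> c (snd p)) \<and>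
      real (card (E \<inter> (N z \<inter> c (fst p)) \<times> (N z \<inter> c (snd p))))
        \<le> e / 2 * (card (N z \<inter> c (fst p)) * card (N z \<inter> c (snd p)))" for z p
  define B where "B = {p \<in> P. \<exists>z\<in>V. good z p}"
  define A1 where "A1 = {x \<in> V. card (c x) < m}"
  define A2 where "A2 = {p \<in> E. block_avg P l f p < e}"
  define A3 where "A3 = {(x, y) \<in> E. \<exists>z. (x, z) \<in> E \<and> (y, z) \<in> E \<and> card (N z \<inter> c x) < e * card (c x)}"

  have cover: "E \<subseteq> A1 \<times> V \<union> V \<times> A1 \<union> A2 \<union> A3 \<union> prod.swap ` A3 \<union> B"
  proof (rule subsetI)
    fix p assume "p \<in> E"
    obtain x y where p: "p = (x, y)" by fastforce
    have xy: "(x, y) \<in> E" "(y, x) \<in> E" "x \<in> V" "y \<in> V"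
      using \<open>p \<in> E\<close> p \<open>sym E\<close> EV by (auto dest: symD)
    obtain z where z: "(x, z) \<in> E" "(y, z) \<in> E" using tri xy(1) by blast
    show "p \<in> A1 \<times> V \<union> V \<times> A1 \<union> A2 \<union> A3 \<union> prod.swap ` A3 \<union> B"
    proof (rule ccontr)
      assume not: "p \<notin> A1 \<times> V \<union> V \<times> A1 \<union> A2 \<union> A3 \<union> prod.swap ` A3 \<union> B"
      then have cy: "m \<le> card (c y)" and av: "e \<le> block_avg P l f (x, y)"
        using xy by (auto simp: p A1_def A2_def)
      have "(x, y) \<notin> A3" "(y, x) \<notin> A3" using not p by force+
      then have hx: "e * card (c x) \<le> card (N z \<inter> c x)" and hy: "e * card (c y) \<le> card (N z \<inter> c y)"
        using xy z by (auto simp: A3_def not_less)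
      let ?S = "N z \<inter> c x" and ?T = "N z \<inter> c y"
      \<comment> \<open>All of \<open>?S\<close> and \<open>?T\<close> is adjacent to
        \<open>z\<close>, so an edge from \<open>x'\<close> in \<open>?S\<close> to
        \<open>?T\<close> ends in a common neighbour of \<open>x'\<close> and \<open>z\<close>, and
        there are at most \<open>D\<close> of these. The hypothesis \<open>large\<close> is what
        makes \<open>D\<close> at most \<open>e / 2\<close> times the size of \<open>?T\<close>,
        hence the density between the two parts at most \<open>e / 2\<close>.\<close>
      have "2 * D \<le> e ^ 3 * n / 2 ^ k" using large by (simp add: n_def field_simps)
      also have "\<dots> = e * (e * m)" by (simp add: m_def power3_eq_cube)
      also have "\<dots> \<le> e * card ?T"
        using e cy hy by (meson less_imp_le mult_left_mono order_trans)
      finally have D: "D \<le> e / 2 * card ?T" by simp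
      have "card (E \<inter> ?S \<times> ?T) \<le> card (SIGMA x':?S. {y'. (x', y') \<in> E \<and> (y', z) \<in> E})"
        using finc finG by (intro card_mono finite_SigmaI finite_Int disjI2) (auto simp: N_def)
      also have "\<dots> = (\<Sum>x'\<in>?S. card {y'. (x', y') \<in> E \<and> (y', z) \<in> E})"
        using finc finG by (intro card_SigmaI finite_Int disjI2 ballI)
      also have "\<dots> \<le> (\<Sum>x'\<in>?S. D)" by (intro sum_mono codeg) (auto simp: N_def)
      finally have "real (card (E \<inter> ?S \<times> ?T)) \<le> real (card ?S) * real D"
        by (simp flip: of_nat_mult)
      also have "\<dots> \<le> card ?S * (e / 2 * card ?T)" by (intro mult_left_mono D) auto
      finally have "good z p" unfolding good_def p using av hx hy by (simp add: algebra_simps)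
      then have "p \<in> B" using xy z EV by (auto simp: B_def P_def p)
      with not show False by blast
    qed
  qed

  have a1: "card (A1 \<times> V) \<le> e * n\<^sup>2" "card (V \<times> A1) \<le> e * n\<^sup>2"
  proof -
    have "card A1 \<le> 2 ^ card Z * m"
      unfolding A1_def c_def by (rule card_small_nbrs_classes[OF fin finZ n0(2)])
    also have "\<dots> \<le> 2 ^ k * m" using n0 Z(2) by (intro mult_right_mono power_increasing) auto
    also have "\<dots> = e * n" by (simp add: m_def)
    finally have "card A1 * n \<le> e * n * n" using n0 by (intro mult_right_mono)
    then show "card (A1 \<times> V) \<le> e * n\<^sup>2" "card (V \<times> A1) \<le> e * n\<^sup>2"
      by (simp_all add: card_cartesian_product n_def power2_eq_square mult_ac)
  qed
  have a2: "card A2 \<le> e * n\<^sup>2"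
  proof -
    have "real (card A2) = (\<Sum>p | p \<in> P \<and> block_avg P l f p < e. f p)"
    proof -
      have "{p \<in> P. block_avg P l f p < e} \<inter> E = A2" using EV by (auto simp: A2_def P_def)
      moreover have "(\<Sum>p\<in>S. f p) = card (S \<inter> E)" if "finite S" for S
        using that by (simp add: f_def of_bool_def sum.If_cases)
      ultimately show ?thesis using finP by simp
    qed
    also have "\<dots> \<le> e * card P" by (rule sum_low_blocks_le) (use finP e in \<open>auto simp: f_def\<close>)
    finally show ?thesis using cardP by simp
  qed
  \<comment> \<open>For fixed \<open>z\<close>, at most \<open>e * n\<close> vertices of
    \<open>N z\<close> lie in classes where \<open>N z\<close> has density below \<open>e\<close>.
    Each is the first end of at most \<open>D\<close> edges that form a triangle with
    \<open>z\<close>; sum over \<open>z\<close>.\<close>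
  have a3: "card A3 \<le> D * e * n\<^sup>2"
  proof -
    define L where "L z = {x \<in> N z. card (N z \<inter> c x) < e * card (c x)}" for z
    have finL: "finite (L z)" for z using NV fin by (auto simp: L_def intro: finite_subset)
    have L: "card (L z) \<le> e * n" for z
    proof -
      let ?g = "\<lambda>x. of_bool (x \<in> N z) :: real"
      have avg: "block_avg V (nbrs E Z) ?g x = card (N z \<inter> c x) / card (c x)" for x
        unfolding block_avg_def c_def using fin
        by (simp add: of_bool_def sum.If_cases Int_commute)
      have "real (card (L z)) \<le> (\<Sum>x | x \<in> V \<and> block_avg V (nbrs E Z) ?g x < e. ?g x)"
      proof -
        have "L z \<subseteq> {x. x \<in> V \<and> block_avg V (nbrs E Z) ?g x < e} \<inter> N z"
        proof
          fix x assume x: "x \<in> L z"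
          then have "x \<in> V" using NV by (auto simp: L_def)
          then have "card (c x) > 0" using finc[of x] by (auto simp: card_gt_0_iff c_def)
          then show "x \<in> {x. x \<in> V \<and> block_avg V (nbrs E Z) ?g x < e} \<inter> N z"
            using x \<open>x \<in> V\<close> by (auto simp: L_def avg field_simps)
        qed
        then have "card (L z) \<le> card ({x. x \<in> V \<and> block_avg V (nbrs E Z) ?g x < e} \<inter> N z)"
          using fin by (intro card_mono) auto
        also have "real \<dots> = (\<Sum>x | x \<in> V \<and> block_avg V (nbrs E Z) ?g x < e. ?g x)"
          using fin by (simp add: of_bool_def sum.If_cases)
        finally show ?thesis by simp
      qed
      also have "\<dots> \<le> e * card V" by (rule sum_low_blocks_le) (use fin e in auto)
      finally show ?thesis by (simp add: n_def)
    qed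
    have "A3 \<subseteq> (\<Union>z\<in>V. SIGMA x:L z. {y. (x, y) \<in> E \<and> (y, z) \<in> E})"
    proof
      fix p assume "p \<in> A3"
      then obtain x y z where "p = (x, y)" "(x, y) \<in> E" "(x, z) \<in> E" "(y, z) \<in> E" "x \<in> L z"
        by (auto simp: A3_def L_def N_def)
      moreover have "z \<in> V" using \<open>(x, z) \<in> E\<close> EV by auto
      ultimately show "p \<in> (\<Union>z\<in>V. SIGMA x:L z. {y. (x, y) \<in> E \<and> (y, z) \<in> E})" by auto
    qed
    moreover have finS: "finite (SIGMA x:L z. {y. (x, y) \<in> E \<and> (y, z) \<in> E})" for z
      using finL finG by (intro finite_SigmaI)
    ultimately have "card A3 \<le> card (\<Union>z\<in>V. SIGMA x:L z. {y. (x, y) \<in> E \<and> (y, z) \<in> E})"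
      using fin by (intro card_mono) auto
    also have "\<dots> \<le> (\<Sum>z\<in>V. card (SIGMA x:L z. {y. (x, y) \<in> E \<and> (y, z) \<in> E}))"
      by (rule card_UN_le[OF fin])
    also have "\<dots> = (\<Sum>z\<in>V. \<Sum>x\<in>L z. card {y. (x, y) \<in> E \<and> (y, z) \<in> E})"
      using finL finG by (intro sum.cong refl card_SigmaI ballI)
    also have "\<dots> \<le> (\<Sum>z\<in>V. \<Sum>x\<in>L z. D)"
      by (intro sum_mono codeg) (auto simp: L_def N_def)
    finally have "real (card A3) \<le> real (\<Sum>z\<in>V. \<Sum>x\<in>L z. D)" by (simp only: of_nat_le_iff)
    also have "\<dots> = (\<Sum>z\<in>V. card (L z) * real D)" by simp
    also have "\<dots> \<le> (\<Sum>z\<in>V. e * n * D)" by (intro sum_mono mult_right_mono L) auto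
    also have "\<dots> = D * e * n\<^sup>2" by (simp add: n_def power2_eq_square)
    finally show ?thesis .
  qed
  \<comment> \<open>The exceptional edges number at most \<open>(3 + 2 * D) * e * n\<^sup>2\<close>:
    three sets of size \<open>e * n\<^sup>2\<close>, and \<open>A3\<close> together with its mirror
    image. This explains the factor \<open>4 + 2 * D\<close> in the hypothesis.\<close>
  have B: "e * n\<^sup>2 < card B"
  proof -
    have fin3: "finite A3" using finE by (rule finite_subset[rotated]) (auto simp: A3_def)
    have "card E \<le> card (A1 \<times> V \<union> V \<times> A1 \<union> A2 \<union> A3 \<union> prod.swap ` A3 \<union> B)"
      using fin finE finP fin3 by (intro card_mono cover) (auto simp: A1_def A2_def B_def)
    also have "\<dots> \<le> card (A1 \<times> V) + card (V \<times> A1) + card A2 + card A3 + card (prod.swap ` A3) + card B"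
      by (intro order_trans[OF card_Un_le] add_mono order_refl)
    also have "card (prod.swap ` A3) = card A3" by (intro card_image) auto
    finally have "real (card E) \<le> card (A1 \<times> V) + card (V \<times> A1) + card A2 + card A3 + card A3 + card B"
      by linarith
    then show ?thesis using a1 a2 a3 many by (simp add: n_def algebra_simps)
  qed

  \<comment> \<open>Choosing the apex per pair of classes and not per edge bounds the number of new
    vertices by \<open>4 ^ k\<close>, the number of pairs of labels.\<close>
  have "\<forall>b\<in>l ` B. \<exists>z\<in>V. \<forall>p\<in>B. l p = b \<longrightarrow> good z p"
  proof
    fix b assume "b \<in> l ` B"
    then obtain p0 where p0: "p0 \<in> B" "l p0 = b" by blast
    then obtain z where z: "z \<in> V" "good z p0" by (auto simp: B_def)
    have "good z p" if "l p = b" for p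
    proof -
      have "l p = l p0" using that p0 by simp
      then have "c (fst p) = c (fst p0)" "c (snd p) = c (snd p0)" "block_avg P l f p = block_avg P l f p0"
        by (auto simp: c_def l_def map_prod_def case_prod_beta intro!: block_avg_cong)
      then show ?thesis using z(2) unfolding good_def by metis
    qed
    then show "\<exists>z\<in>V. \<forall>p\<in>B. l p = b \<longrightarrow> good z p" using z by blast
  qed
  then obtain g where g: "\<And>p. p \<in> B \<Longrightarrow> g (l p) \<in> V \<and> good (g (l p)) p" by (metis imageI)
  define Z' where "Z' = Z \<union> g ` l ` B"
  define l' where "l' = map_prod (nbrs E Z') (nbrs E Z')"
  have "card (l ` B) \<le> card (Pow Z \<times> Pow Z)"
    by (rule card_mono) (use finZ in \<open>auto simp: l_def nbrs_def\<close>)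
  also have "\<dots> = 4 ^ card Z"
    by (simp add: card_cartesian_product card_Pow finZ flip: power_mult_distrib)
  also have "\<dots> \<le> 4 ^ k" using Z(2) by (intro power_increasing) auto
  finally have "card (l ` B) \<le> 4 ^ k" .
  moreover have "finite (l ` B)" using finP by (simp add: B_def)
  ultimately have "card Z' \<le> k + 4 ^ k"
    unfolding Z'_def using Z(2) card_Un_le[of Z "g ` l ` B"] card_image_le[of "l ` B" g] by linarith
  moreover have "Z' \<subseteq> V" using Z(1) g by (auto simp: Z'_def)
  moreover have "energy P l f + e ^ 5 / 4 * n\<^sup>2 \<le> energy P l' f"
  proof -
    \<comment> \<open>The witness for an edge is \<open>?S \<times> ?T\<close>: it occupies a
      proportion of at least \<open>e\<^sup>2\<close> of its block, and its mean is at most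
      \<open>e / 2\<close> against at least \<open>e\<close> for the block. It is a union of finer
      classes because the labels over \<open>Z'\<close> record adjacency to
      \<open>z\<close>.\<close>
    have "card B * (e\<^sup>2 * (e / 2)\<^sup>2) \<le> energy P l' f - energy P l f"
    proof (rule energy_increment[where P = P and l = l and l' = l' and f = f and B = B and t = "e / 2" and k = "e\<^sup>2", OF finP])
      have "Z \<subseteq> Z'" by (simp add: Z'_def)
      then show "l p = l q" if "p \<in> P" "q \<in> P" "l' p = l' q" for p q
        using that nbrs_mono_eq[of Z Z' E "fst p" "fst q"] nbrs_mono_eq[of Z Z' E "snd p" "snd q"]
        by (simp add: l_def l'_def map_prod_def case_prod_beta)
      show "B \<subseteq> P" "0 \<le> e / 2" "0 \<le> e\<^sup>2" using e by (auto simp: B_def)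
    next
      fix p assume "p \<in> B"
      obtain x y where p: "p = (x, y)" by fastforce
      define z where "z = g (l p)"
      have z: "good z p" "z \<in> Z'" using g[OF \<open>p \<in> B\<close>] \<open>p \<in> B\<close> by (auto simp: z_def Z'_def)
      let ?S = "N z \<inter> c x" and ?T = "N z \<inter> c y"
      have "?S \<times> ?T \<subseteq> {q \<in> P. l q = l p}" unfolding p block by blast
      moreover have "q' \<in> ?S \<times> ?T" if "q \<in> ?S \<times> ?T" "q' \<in> P" "l' q' = l' q" for q q'
      proof -
        have *: "u' \<in> N z \<inter> c v" if "u \<in> N z \<inter> c v" "u' \<in> V" "nbrs E Z' u' = nbrs E Z' u" for u u' v
          using that nbrs_eqD[OF that(3) z(2)] nbrs_mono_eq[OF _ that(3), of Z]
          by (auto simp: N_def c_def Z'_def)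
        show ?thesis using that *[of "fst q" x "fst q'"] *[of "snd q" y "snd q'"]
          by (cases q; cases q') (auto simp: l'_def P_def)
      qed
      moreover have "e\<^sup>2 * card {q \<in> P. l q = l p} \<le> card (?S \<times> ?T)"
      proof -
        have "e * card (c x) * (e * card (c y)) \<le> real (card ?S) * card ?T"
          using z(1) e by (intro mult_mono) (auto simp: good_def p)
        then show ?thesis by (simp add: p block card_cartesian_product power2_eq_square mult_ac)
      qed
      moreover have "(\<Sum>q\<in>?S \<times> ?T. f q) \<le> (block_avg P l f p - e / 2) * card (?S \<times> ?T)"
      proof -
        have "(\<Sum>q\<in>?S \<times> ?T. f q) = card (E \<inter> ?S \<times> ?T)"
          using finc by (simp add: f_def of_bool_def sum.If_cases Int_commute)
        also have "\<dots> \<le> e / 2 * card (?S \<times> ?T)"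
          using z(1) by (simp add: good_def p card_cartesian_product)
        also have "\<dots> \<le> (block_avg P l f p - e / 2) * card (?S \<times> ?T)"
          using z(1) by (intro mult_right_mono) (auto simp: good_def)
        finally show ?thesis .
      qed
      ultimately show "\<exists>W \<subseteq> {q \<in> P. l q = l p}. (\<forall>q\<in>W. \<forall>q'\<in>P. l' q' = l' q \<longrightarrow> q' \<in> W) \<and>
        e\<^sup>2 * card {q \<in> P. l q = l p} \<le> card W \<and> (\<Sum>q\<in>W. f q) \<le> (block_avg P l f p - e / 2) * card W"
        by (intro exI[of _ "?S \<times> ?T"]) blast
    qed
    moreover have "e * n\<^sup>2 * (e\<^sup>2 * (e / 2)\<^sup>2) \<le> card B * (e\<^sup>2 * (e / 2)\<^sup>2)"
      using B by (intro mult_right_mono) auto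
    moreover have "e * n\<^sup>2 * (e\<^sup>2 * (e / 2)\<^sup>2) = e ^ 5 / 4 * n\<^sup>2"
      by (simp add: power2_eq_square eval_nat_numeral)
    ultimately show ?thesis by linarith
  qed
  ultimately show ?thesis
    by (intro exI[of _ Z'] conjI) (simp_all add: P_def l_def l'_def f_def n_def)
qed

text \<open>With too many edges the energy step could be repeated \<open>M\<close> times from the
  empty set. Each step gains \<open>d ^ 5 / 4 * (card V)\<^sup>2\<close>, while the energy is at
  most \<open>(card V)\<^sup>2\<close>, and \<open>M\<close> exceeds \<open>4 / d ^ 5\<close>. The
  bound \<open>K i\<close> on the size after \<open>i\<close> steps is of tower type but depends
  only on \<open>i\<close>, so one \<open>n0\<close> makes the classes large enough for every
  step.\<close>

theorem few_edges_if_few_triangles_per_edge: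
  fixes e :: real and D :: nat
  assumes "0 < e"
  shows "\<exists>n0. \<forall>(V :: 'a set) E. finite V \<longrightarrow> n0 \<le> card V \<longrightarrow> E \<subseteq> V \<times> V \<longrightarrow> sym E \<longrightarrow>
    (\<forall>(x, y) \<in> E. \<exists>z. (x, z) \<in> E \<and> (y, z) \<in> E) \<longrightarrow>
    (\<forall>(x, z) \<in> E. card {y. (x, y) \<in> E \<and> (y, z) \<in> E} \<le> D) \<longrightarrow> card E \<le> e * (card V)\<^sup>2"
proof -
  define d where "d = e / (4 + 2 * D)"
  define K where "K i = ((\<lambda>k. k + 4 ^ k) ^^ i) (0::nat)" for i
  define M where "M = nat \<lceil>4 / d ^ 5\<rceil> + 1"
  define n0 where "n0 = nat \<lceil>2 * D * 2 ^ K M / d ^ 3\<rceil> + 1"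
  have d: "0 < d" using assms by (simp add: d_def add_pos_nonneg)
  have K: "K i \<le> K j" if "i \<le> j" for i j
    by (rule lift_Suc_mono_le[OF _ that]) (simp add: K_def)
  have "card E \<le> e * (card V)\<^sup>2"
    if fin: "finite V" and n0: "n0 \<le> card V" and EV: "E \<subseteq> V \<times> V" and "sym E"
      and tri: "\<forall>(x, y) \<in> E. \<exists>z. (x, z) \<in> E \<and> (y, z) \<in> E"
      and codeg: "\<forall>(x, z) \<in> E. card {y. (x, y) \<in> E \<and> (y, z) \<in> E} \<le> D"
    for V :: "'a set" and E
  proof (rule ccontr)
    assume "\<not> ?thesis"
    then have many: "(4 + 2 * D) * d * (card V)\<^sup>2 < card E"
      by (simp add: d_def add_nonneg_eq_0_iff)
    have tri': "\<exists>z. (x, z) \<in> E \<and> (y, z) \<in> E" if "(x, y) \<in> E" for x y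
      using tri that by blast
    have codeg': "card {y. (x, y) \<in> E \<and> (y, z) \<in> E} \<le> D" if "(x, z) \<in> E" for x z
      using codeg that by blast
    define en where
      "en Z = energy (V \<times> V) (map_prod (nbrs E Z) (nbrs E Z)) (\<lambda>p. of_bool (p \<in> E))" for Z
    have "\<exists>Z \<subseteq> V. card Z \<le> K i \<and> i * (d ^ 5 / 4 * (card V)\<^sup>2) \<le> en Z" if "i \<le> M" for i
      using that
    proof (induction i)
      case 0
      then show ?case using energy_nonneg by (intro exI[of _ "{}"]) (auto simp: en_def)
    next
      case (Suc i)
      then obtain Z where Z: "Z \<subseteq> V" "card Z \<le> K i" "i * (d ^ 5 / 4 * (card V)\<^sup>2) \<le> en Z" by auto
      have "real (2 * D) * 2 ^ K i \<le> real (2 * D) * 2 ^ K M"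
        using K[of i M] Suc.prems by (intro mult_left_mono power_increasing) auto
      also have "real (2 * D) * 2 ^ K M / d ^ 3 \<le> card V" using n0 unfolding n0_def by simp linarith
      then have "real (2 * D) * 2 ^ K M \<le> d ^ 3 * card V" using d by (simp add: field_simps)
      finally have large: "2 * D * 2 ^ K i \<le> d ^ 3 * card V" by simp
      obtain Z' where "Z' \<subseteq> V" "card Z' \<le> K i + 4 ^ K i" "en Z + d ^ 5 / 4 * (card V)\<^sup>2 \<le> en Z'"
        unfolding en_def
        using triangle_energy_step[OF fin EV \<open>sym E\<close> tri' codeg' d Z(1,2) large many] by blast
      moreover have "K (Suc i) = K i + 4 ^ K i" by (simp add: K_def)
      ultimately show ?case using Z(3) by (intro exI[of _ Z']) (auto simp: algebra_simps)
    qed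
    then obtain Z where Z: "M * (d ^ 5 / 4 * (card V)\<^sup>2) \<le> en Z" by blast
    also have "en Z \<le> card (V \<times> V)" unfolding en_def by (rule energy_le_card) auto
    also have "\<dots> = 1 * (card V)\<^sup>2" by (simp add: card_cartesian_product power2_eq_square)
    finally have "M * (d ^ 5 / 4) * (card V)\<^sup>2 \<le> 1 * (card V)\<^sup>2" by (simp add: mult.assoc)
    moreover have "0 < (card V)\<^sup>2" using n0 by (simp add: n0_def)
    ultimately have "M * (d ^ 5 / 4) \<le> 1" by (simp add: mult_le_cancel_right)
    moreover have "4 / d ^ 5 < M" unfolding M_def by linarith
    then have "1 < M * (d ^ 5 / 4)" using d by (simp add: field_simps)
    ultimately show False by simp
  qed
  then show ?thesis by (intro exI[of _ n0]) blast
qed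

subsection \<open>Sparse paving matroids\<close>

lemma matroid_finite: "matroid E I \<Longrightarrow> X \<in> I \<Longrightarrow> finite X"
  unfolding matroid_def by (meson PowD finite_subset subsetD)

lemma matroid_subset: "matroid E I \<Longrightarrow> Y \<in> I \<Longrightarrow> X \<subseteq> Y \<Longrightarrow> X \<in> I"
  unfolding matroid_def by blast

lemma matroid_augment:
  "matroid E I \<Longrightarrow> X \<in> I \<Longrightarrow> Y \<in> I \<Longrightarrow> card X < card Y \<Longrightarrow> \<exists>y\<in>Y - X. insert y X \<in> I"
  unfolding matroid_def by metis

lemma matroid_extend:
  assumes "matroid E I" "X \<in> I" "Y \<in> I" "card X \<le> card Y"
  shows "\<exists>Z. X \<subseteq> Z \<and> Z \<subseteq> X \<union> Y \<and> Z \<in> I \<and> card Z = card Y"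
  using assms(2,4)
proof (induction "card Y - card X" arbitrary: X)
  case 0
  then show ?case by (intro exI[of _ X]) auto
next
  case (Suc k)
  then obtain y where y: "y \<in> Y - X" "insert y X \<in> I"
    using matroid_augment[OF assms(1)] assms(3) by (metis zero_less_Suc zero_less_diff)
  have "finite X" using assms(1) Suc.prems by (simp add: matroid_finite)
  then have "k = card Y - card (insert y X)" "card (insert y X) \<le> card Y" using y Suc.hyps(2) by auto
  then obtain Z where "insert y X \<subseteq> Z" "Z \<subseteq> insert y X \<union> Y" "Z \<in> I" "card Z = card Y"
    using Suc.hyps(1)[of "insert y X"] y by blast
  then show ?case using y by (intro exI[of _ Z]) auto
qed

lemma mrank_eqI:
  assumes "X \<subseteq> A" "X \<in> I" "card X = k" "\<And>Y. Y \<subseteq> A \<Longrightarrow> Y \<in> I \<Longrightarrow> card Y \<le> k"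
  shows "mrank I A = k"
proof -
  have "finite {card X | X. X \<subseteq> A \<and> X \<in> I}"
    by (rule finite_subset[of _ "{..k}"]) (use assms(4) in auto)
  then show ?thesis unfolding mrank_def
    by (intro Max_eqI) (use assms in auto)
qed

text \<open>A stable set in the Johnson graph of \<open>r\<close>-subsets; its members will be the
  circuit-hyperplanes.\<close>

definition exchange_free :: "'a set \<Rightarrow> nat \<Rightarrow> 'a set set \<Rightarrow> bool" where
  "exchange_free E r S \<longleftrightarrow> (\<forall>A\<in>S. A \<subseteq> E \<and> card A = r) \<and>
    (\<forall>A\<in>S. \<forall>x\<in>A. \<forall>y\<in>E - A. insert y (A - {x}) \<notin> S)"

text \<open>If augmentation of \<open>X\<close> by \<open>Y\<close> fails, every one-point extension
  of \<open>X\<close> into \<open>Y\<close> lies in \<open>S\<close>. Two such extensions would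
  differ by one exchange, and if there is only one, it equals \<open>Y\<close>, which is
  independent. A circuit of rank below \<open>r\<close> has at most \<open>r\<close> elements, as
  one with \<open>r + 1\<close> elements contains a basis, so it belongs to \<open>S\<close>. Adding
  a point to it raises the rank because an exchange leads out of \<open>S\<close>.\<close>

lemma sparse_paving_exchange_free:
  assumes "finite E" "0 < r" "r < card E" and S: "exchange_free E r S"
  defines "I \<equiv> {X. X \<subseteq> E \<and> card X \<le> r \<and> X \<notin> S}"
  shows "sparse_paving E I"
proof -
  have SE: "A \<subseteq> E" "card A = r" if "A \<in> S" for A using S that by (auto simp: exchange_free_def)
  have ex: "insert y (A - {x}) \<notin> S" if "A \<in> S" "x \<in> A" "y \<in> E" "y \<notin> A" for A x y
    using S that by (auto simp: exchange_free_def)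
  have finE: "finite X" if "X \<subseteq> E" for X using that assms(1) by (rule finite_subset)
  have "matroid E I" unfolding matroid_def
  proof (intro conjI allI impI)
    show "{} \<in> I" using SE(2)[of "{}"] \<open>0 < r\<close> by (auto simp: I_def)
  next
    fix X Y assume XY: "Y \<in> I \<and> X \<subseteq> Y"
    show "X \<in> I"
    proof (cases "X = Y")
      case False
      then have "card X < card Y" using XY finE by (auto simp: I_def intro!: psubset_card_mono)
      then show ?thesis using XY SE(2)[of X] by (auto simp: I_def)
    qed (use XY in simp)
  next
    fix X Y assume XY: "X \<in> I \<and> Y \<in> I \<and> card X < card Y"
    then have fin: "finite X" "finite Y" by (auto simp: I_def finE)
    show "\<exists>y\<in>Y - X. insert y X \<in> I"
    proof (rule ccontr)
      assume not: "\<not> ?thesis"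
      obtain y where y: "y \<in> Y - X" using XY fin by (metis card_mono DiffI not_le subsetI)
      have inS: "insert z X \<in> S" if "z \<in> Y - X" for z
        using not that XY fin by (auto simp: I_def)
      have "Y - X = {y}"
      proof (rule ccontr)
        assume "Y - X \<noteq> {y}"
        then obtain z where z: "z \<in> Y - X" "z \<noteq> y" using y by blast
        then have "insert z (insert y X - {y}) \<notin> S" using inS[OF y] XY by (intro ex) (auto simp: I_def)
        then show False using inS[OF z(1)] y by simp
      qed
      then have "Y \<subseteq> insert y X" by blast
      moreover have "card (insert y X) \<le> card Y" using XY fin y by simp
      ultimately have "Y = insert y X" using fin by (intro card_seteq) auto
      then show False using inS[OF y] XY by (auto simp: I_def)
    qed
  qed (use assms(1) in \<open>auto simp: I_def\<close>)
  moreover have rankE: "mrank I E = r"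
  proof -
    obtain A where A: "A \<subseteq> E" "card A = r" using \<open>r < card E\<close> obtain_subset_with_card_n[of r E] by auto
    have "\<exists>B \<subseteq> E. B \<in> I \<and> card B = r"
    proof (cases "A \<in> S")
      case True
      obtain x where x: "x \<in> A" using A \<open>0 < r\<close> by fastforce
      have "A \<noteq> E" using A \<open>r < card E\<close> by auto
      then obtain y where y: "y \<in> E" "y \<notin> A" using A by blast
      have "card (insert y (A - {x})) = r" using x y A finE[OF A(1)] \<open>0 < r\<close> by simp
      then show ?thesis using ex[OF True x y] A y by (intro exI[of _ "insert y (A - {x})"]) (auto simp: I_def)
    qed (use A in \<open>auto simp: I_def\<close>)
    then obtain B where "B \<subseteq> E" "B \<in> I" "card B = r" by blast
    then show ?thesis by (rule mrank_eqI) (simp add: I_def)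
  qed
  moreover have "hyperplane E I C" if C: "circuit E I C" "mrank I C < mrank I E" for C
  proof -
    have CE: "C \<subseteq> E" "C \<notin> I" "\<And>x. x \<in> C \<Longrightarrow> C - {x} \<in> I" using C(1) by (auto simp: circuit_def)
    have "C \<noteq> {}" using CE(2) \<open>matroid E I\<close> by (auto simp: matroid_def)
    then obtain x where x: "x \<in> C" by blast
    have "card (C - {x}) \<le> r" using CE(3)[OF x] by (simp add: I_def)
    then have "card C \<le> Suc r" using x finE[OF CE(1)] by simp
    moreover have "card C \<noteq> Suc r"
    proof
      assume "card C = Suc r"
      then have "mrank I C = r"
        using x CE(3)[OF x] finE[OF CE(1)] by (intro mrank_eqI[of "C - {x}"]) (auto simp: I_def)
      then show False using C(2) rankE by simp
    qed
    ultimately have "C \<in> S" using CE by (auto simp: I_def)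
    have rC: "mrank I C = r - 1"
    proof (rule mrank_eqI)
      show "card (C - {x}) = r - 1" using x SE(2)[OF \<open>C \<in> S\<close>] by simp
      fix Y assume "Y \<subseteq> C" "Y \<in> I"
      then have "Y \<subset> C" using CE(2) by blast
      then have "card Y < r" using SE(2)[OF \<open>C \<in> S\<close>] finE[OF CE(1)] by (metis psubset_card_mono)
      then show "card Y \<le> r - 1" by simp
    qed (use CE x in auto)
    have "mrank I (insert y C) = r" if y: "y \<in> E" "y \<notin> C" for y
    proof (rule mrank_eqI)
      show "insert y (C - {x}) \<in> I" "card (insert y (C - {x})) = r"
        using ex[OF \<open>C \<in> S\<close> x y] CE(1) y x SE(2)[OF \<open>C \<in> S\<close>] finE[OF CE(1)] \<open>0 < r\<close>
        by (auto simp: I_def)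
    qed (auto simp: I_def)
    then show ?thesis using rC rankE CE(1) \<open>0 < r\<close> by (auto simp: hyperplane_def flat_def)
  qed
  ultimately show ?thesis by (simp add: sparse_paving_def)
qed

lemma finite_indep_families: "finite {I. matroid {1..n::nat} I \<and> P I}"
  by (rule finite_subset[of _ "Pow (Pow {1..n})"]) (auto simp: matroid_def)

text \<open>The Graham--Sloane construction: elements of an \<open>r\<close>-set are summed modulo \<open>n\<close>, and
  exchanging one element changes the sum.\<close>
lemma exists_large_exchange_free:
  assumes "0 < n"
  obtains S where "exchange_free {1..n} r S" "n choose r \<le> n * card S"
proof -
  let ?A = "{A. A \<subseteq> {1..n} \<and> card A = r}"
  let ?S = "\<lambda>j. {A \<in> ?A. \<Sum>A mod n = j}"
  have "\<exists>j<n. n choose r \<le> n * card (?S j)"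
  proof (rule ccontr)
    assume "\<not> ?thesis"
    then have "\<And>j. j \<in> {..<n} \<Longrightarrow> n * card (?S j) < n choose r" by auto
    then have "(\<Sum>j<n. n * card (?S j)) < (\<Sum>j<n. n choose r)"
      using assms by (intro sum_strict_mono) auto
    moreover have "(\<Sum>j<n. card (?S j)) = card ?A"
      using sum.group[of ?A "{..<n}" "\<lambda>A. \<Sum>A mod n" "\<lambda>_. 1::nat"] assms
      by (simp add: image_subset_iff)
    ultimately show False by (simp add: n_subsets flip: sum_distrib_left)
  qed
  then obtain j where j: "n choose r \<le> n * card (?S j)" by blast
  have "exchange_free {1..n} r (?S j)"
    unfolding exchange_free_def
  proof (intro conjI ballI notI)
    fix A x y assume A: "A \<in> ?S j" "x \<in> A" "y \<in> {1..n} - A" and B: "insert y (A - {x}) \<in> ?S j"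
    have "finite A" using A by (auto intro: finite_subset)
    then have "\<Sum>(insert y (A - {x})) = y + \<Sum>(A - {x})" "\<Sum>A = x + \<Sum>(A - {x})"
      using A by (auto simp: sum.remove)
    then have "(y + \<Sum>(A - {x})) mod n = (x + \<Sum>(A - {x})) mod n" using A B by simp
    then have "int (y + \<Sum>(A - {x})) mod int n = int (x + \<Sum>(A - {x})) mod int n"
      by (metis of_nat_mod)
    then have "int n dvd int y - int x" by (simp add: mod_eq_dvd_iff)
    moreover have "x \<in> {1..n}" "y \<in> {1..n}" "x \<noteq> y" using A by auto
    ultimately show False using dvd_imp_le_int[of "int y - int x" "int n"] by auto
  qed auto
  then show ?thesis using that j by blast
qed

text \<open>Subsets of an exchange-free family are exchange-free and give distinct matroids, so a
  single large family yields exponentially many.\<close>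

theorem s_sp_ge:
  assumes "0 < r" "r < n"
  shows "2 powr ((n choose r) / n) \<le> s_sp n"
proof -
  obtain S where S: "exchange_free {1..n} r S" "n choose r \<le> n * card S"
    using exists_large_exchange_free[of n r] assms by auto
  define f where "f T = {X. X \<subseteq> {1..n} \<and> card X \<le> r \<and> X \<notin> T}" for T
  have "f ` Pow S \<subseteq> {I. sparse_paving {1..n} I}"
  proof safe
    fix T assume "T \<subseteq> S"
    then have "exchange_free {1..n} r T" using S(1) unfolding exchange_free_def by blast
    then show "sparse_paving {1..n} (f T)"
      unfolding f_def using assms by (intro sparse_paving_exchange_free) auto
  qed
  moreover have "finite {I. sparse_paving {1..n} I}"
    unfolding sparse_paving_def by (rule finite_indep_families)
  ultimately have "card (f ` Pow S) \<le> s_sp n" unfolding s_sp_def by (rule card_mono[rotated])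
  moreover have "inj_on f (Pow S)"
  proof (rule inj_onI)
    fix T T' assume T: "T \<in> Pow S" "T' \<in> Pow S" "f T = f T'"
    have "X \<in> T \<longleftrightarrow> X \<in> T'" if "X \<in> S" for X
    proof -
      have "X \<subseteq> {1..n}" "card X \<le> r" using S(1) that by (auto simp: exchange_free_def)
      then have "X \<in> f U \<longleftrightarrow> X \<notin> U" for U by (simp add: f_def)
      then show ?thesis using T(3) by metis
    qed
    then show "T = T'" using T by blast
  qed
  moreover have "finite S"
    by (rule finite_subset[of _ "Pow {1..n}"]) (use S(1) in \<open>auto simp: exchange_free_def\<close>)
  ultimately have le: "2 ^ card S \<le> s_sp n" by (simp add: card_image card_Pow)
  have "2 powr ((n choose r) / n) \<le> 2 powr card S"
    using S(2) assms by (intro powr_mono) (auto simp: field_simps simp flip: of_nat_mult)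
  also have "\<dots> = real (2 ^ card S)" by (simp add: powr_realpow)
  also have "\<dots> \<le> s_sp n" using le by (rule of_nat_mono)
  finally show ?thesis .
qed

subsection \<open>Spaces of points and lines\<close>

lemma ex_next:
  fixes L :: "nat set"
  assumes "finite L" "w0 \<in> L" "y < w0"
  obtains w where "w \<in> L" "y < w" "\<And>v. v \<in> L \<Longrightarrow> y < v \<Longrightarrow> w \<le> v"
proof -
  have "Min {w \<in> L. y < w} \<in> {w \<in> L. y < w}" using assms by (intro Min_in) auto
  then show ?thesis using assms(1) by (intro that[of "Min {w \<in> L. y < w}"]) auto
qed

lemma ex_previous:
  fixes L :: "nat set"
  assumes "finite L" "w0 \<in> L" "w0 < y"
  obtains w where "w \<in> L" "w < y" "\<And>v. v \<in> L \<Longrightarrow> v < y \<Longrightarrow> v \<le> w"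
proof -
  have "Max {w \<in> L. w < y} \<in> {w \<in> L. w < y}" using assms by (intro Max_in) auto
  then show ?thesis using assms(1) by (intro that[of "Max {w \<in> L. w < y}"]) auto
qed

text \<open>The simple rank-3 geometry on one point per parallel class, reduced to its collinear
  triples of distinct points. Two-point lines leave no trace in \<open>col\<close>;
  \<open>col_trans\<close> says that two points determine their line.\<close>

locale line_space =
  fixes R :: "nat set" and col :: "nat \<Rightarrow> nat \<Rightarrow> nat \<Rightarrow> bool"
  assumes finite_R: "finite R"
    and col_in: "col x y z \<Longrightarrow> x \<in> R" and col_neq: "col x y z \<Longrightarrow> x \<noteq> y"
    and col_swap: "col x y z \<Longrightarrow> col y x z" and col_rotate: "col x y z \<Longrightarrow> col y z x"
    and col_trans: "col x y z \<Longrightarrow> col x y w \<Longrightarrow> z \<noteq> w \<Longrightarrow> col y z w"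
begin

definition line :: "nat \<Rightarrow> nat \<Rightarrow> nat set" where
  "line x y = {w. w = x \<or> w = y \<or> col x y w}"

text \<open>The strip graph: on each line with at least three points, a point is joined to the next two
  points in the order of the line.\<close>
definition strip :: "(nat \<times> nat) set" where
  "strip = {(x, y). (\<exists>w. col x y w) \<and> card {w \<in> line x y. min x y < w \<and> w < max x y} \<le> 1}"

lemma col_distinct: "col x y z \<Longrightarrow> x \<noteq> y \<and> x \<noteq> z \<and> y \<noteq> z"
  using col_neq col_rotate by metis

lemma line_commute: "line x y = line y x"
  by (auto simp: line_def intro: col_swap)

lemma finite_line: "finite (line x y)"
proof (rule finite_subset)
  show "line x y \<subseteq> insert x (insert y R)"
    by (auto simp: line_def intro: col_in col_rotate)
qed (simp add: finite_R)

lemma line_eq_pivot: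
  assumes "w \<in> line x y" "w \<noteq> x" shows "line x w = line x y"
proof (cases "w = y")
  case False
  then have w: "col x y w" using assms by (simp add: line_def)
  have "col x w z \<longleftrightarrow> col x y z" if "z \<noteq> y" "z \<noteq> w" for z
    using that w col_swap col_rotate col_trans by metis
  moreover have "col x w y" using w col_swap col_rotate by metis
  ultimately have "z \<in> line x w \<longleftrightarrow> z \<in> line x y" for z
    using w by (cases "z = y"; cases "z = w") (simp_all add: line_def)
  then show ?thesis by blast
qed simp

lemma line_eq:
  assumes "u \<in> line x y" "v \<in> line x y" "u \<noteq> v" shows "line u v = line x y"
proof (cases "u = x")
  case True
  then show ?thesis using assms line_eq_pivot by metis
next
  case False
  then have "line x u = line x y" using assms line_eq_pivot by metis
  then show ?thesis using assms line_eq_pivot line_commute by metis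
qed

lemma col_if_line:
  "u \<in> line x y \<Longrightarrow> v \<in> line x y \<Longrightarrow> w \<in> line x y \<Longrightarrow> u \<noteq> v \<Longrightarrow> u \<noteq> w \<Longrightarrow> v \<noteq> w \<Longrightarrow> col u v w"
  using line_eq[of u x y v] by (auto simp: line_def)

lemma stripI:
  assumes "col x y z" "u \<in> line x y" "v \<in> line x y" "u < v"
    and "card {w \<in> line x y. u < w \<and> w < v} \<le> 1"
  shows "(u, v) \<in> strip"
proof -
  have xyz: "x \<noteq> y" "x \<noteq> z" "y \<noteq> z" using col_distinct[OF assms(1)] by simp_all
  then obtain w where "w \<in> {x, y, z}" "w \<noteq> u" "w \<noteq> v" by (metis insertCI)
  moreover have "{x, y, z} \<subseteq> line x y" using assms(1) by (auto simp: line_def)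
  ultimately have "col u v w" using assms by (intro col_if_line[of u x y]) auto
  moreover have "line u v = line x y" using assms by (intro line_eq) auto
  ultimately show ?thesis using assms by (auto simp: strip_def min_def max_def)
qed

lemma sym_strip: "sym strip"
  by (rule symI) (auto simp: strip_def line_commute min.commute max.commute intro: col_swap)

lemma strip_subset: "strip \<subseteq> R \<times> R"
  by (auto simp: strip_def intro: col_in col_rotate)

text \<open>For \<open>x < y\<close> the third vertex is the single point between them if there is
  one, otherwise the next point above \<open>y\<close>, otherwise the last point below
  \<open>x\<close>. One of these exists because the line has a third point.\<close>

lemma strip_in_triangle:
  assumes "(x, y) \<in> strip"
  shows "\<exists>z. (x, z) \<in> strip \<and> (y, z) \<in> strip"
proof -
  have "\<exists>z. (x, z) \<in> strip \<and> (y, z) \<in> strip" if xy: "x < y" "(x, y) \<in> strip" for x y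
  proof -
    let ?L = "line x y"
    obtain z where z: "col x y z" using xy by (auto simp: strip_def)
    have zL: "z \<in> ?L" "x \<in> ?L" "y \<in> ?L" "z \<noteq> x" "z \<noteq> y"
      using z col_distinct[OF z] by (simp_all add: line_def)
    have sI: "(u, v) \<in> strip" "(v, u) \<in> strip"
      if "u \<in> ?L" "v \<in> ?L" "u < v" "{w \<in> ?L. u < w \<and> w < v} \<subseteq> {t}" for u v t
    proof -
      have "card {w \<in> ?L. u < w \<and> w < v} \<le> card {t}" by (rule card_mono[OF _ that(4)]) simp
      then show "(u, v) \<in> strip" using that z by (intro stripI[of x y z]) auto
      then show "(v, u) \<in> strip" by (rule symD[OF sym_strip])
    qed
    let ?B = "{w \<in> ?L. x < w \<and> w < y}"
    have fin: "finite ?L" by (rule finite_line)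
    have cB: "card ?B \<le> 1" using xy by (simp add: strip_def)
    show ?thesis
    proof (cases "?B = {}")
      case False
      then obtain w where w: "w \<in> ?B" by blast
      have B: "v = w" if "v \<in> ?L" "x < v" "v < y" for v
        using that w cB fin card_le_Suc0_iff_eq[of ?B] by simp
      have "{v \<in> ?L. x < v \<and> v < w} \<subseteq> {w}" "{v \<in> ?L. w < v \<and> v < y} \<subseteq> {w}"
        using w by (auto intro: B)
      then show ?thesis using w zL sI[of x w w] sI[of w y w] by blast
    next
      case empty: True
      show ?thesis
      proof (cases "\<exists>w\<in>?L. y < w")
        case True
        then obtain w where w: "w \<in> ?L" "y < w" "\<And>v. v \<in> ?L \<Longrightarrow> y < v \<Longrightarrow> w \<le> v"
          using ex_next[OF fin] by blast
        have "v = y" if "v \<in> ?L" "x < v" "v < w" for v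
          using empty w(3)[of v] that by (cases v y rule: linorder_cases) auto
        then have "{v \<in> ?L. y < v \<and> v < w} \<subseteq> {y}" "{v \<in> ?L. x < v \<and> v < w} \<subseteq> {y}"
          using \<open>x < y\<close> by auto
        then have "(x, w) \<in> strip" "(y, w) \<in> strip"
          using sI(1)[of x w y] sI(1)[of y w y] w(1,2) zL \<open>x < y\<close> by simp_all
        then show ?thesis by blast
      next
        case False
        then have "z < x" using zL empty by (cases z x rule: linorder_cases; cases z y rule: linorder_cases) auto
        then obtain w where w: "w \<in> ?L" "w < x" "\<And>v. v \<in> ?L \<Longrightarrow> v < x \<Longrightarrow> v \<le> w"
          using ex_previous[OF fin zL(1)] by blast
        have "v = x" if "v \<in> ?L" "w < v" "v < y" for v
          using empty w(3)[of v] that by (cases v x rule: linorder_cases) auto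
        then have "{v \<in> ?L. w < v \<and> v < x} \<subseteq> {x}" "{v \<in> ?L. w < v \<and> v < y} \<subseteq> {x}"
          using \<open>x < y\<close> by auto
        then have "(x, w) \<in> strip" "(y, w) \<in> strip"
          using sI(2)[of w x x] sI(2)[of w y x] w(1,2) zL \<open>x < y\<close> by simp_all
        then show ?thesis by blast
      qed
    qed
  qed
  moreover have "x \<noteq> y" using assms col_neq by (auto simp: strip_def)
  ultimately show ?thesis using assms symD[OF sym_strip] by (metis linorder_neqE_nat)
qed

end

lemma card_near_above:
  fixes L :: "nat set"
  assumes "finite L"
  shows "card {y \<in> L. x < y \<and> card {w \<in> L. x < w \<and> w < y} \<le> 1} \<le> 2"
proof -
  let ?r = "\<lambda>y. card {w \<in> L. x < w \<and> w < y}" and ?S = "{y \<in> L. x < y \<and> card {w \<in> L. x < w \<and> w < y} \<le> 1}"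
  have lt: "?r y < ?r y'" if "y \<in> L" "x < y" "y < y'" for y y'
    by (rule psubset_card_mono) (use that assms in auto)
  have "inj_on ?r ?S"
  proof (rule inj_onI)
    fix y y' assume "y \<in> ?S" "y' \<in> ?S" "?r y = ?r y'"
    then show "y = y'" using lt[of y y'] lt[of y' y] by (cases y y' rule: linorder_cases) auto
  qed
  then have "card ?S \<le> card {..1::nat}" by (rule card_inj_on_le) auto
  then show ?thesis by simp
qed

lemma card_near_below:
  fixes L :: "nat set"
  assumes "finite L"
  shows "card {y \<in> L. y < x \<and> card {w \<in> L. y < w \<and> w < x} \<le> 1} \<le> 2"
proof -
  let ?r = "\<lambda>y. card {w \<in> L. y < w \<and> w < x}" and ?S = "{y \<in> L. y < x \<and> card {w \<in> L. y < w \<and> w < x} \<le> 1}"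
  have lt: "?r y < ?r y'" if "y \<in> L" "y < x" "y' < y" for y y'
    by (rule psubset_card_mono) (use that assms in auto)
  have "inj_on ?r ?S"
  proof (rule inj_onI)
    fix y y' assume "y \<in> ?S" "y' \<in> ?S" "?r y = ?r y'"
    then show "y = y'" using lt[of y y'] lt[of y' y] by (cases y y' rule: linorder_cases) auto
  qed
  then have "card ?S \<le> card {..1::nat}" by (rule card_inj_on_le) auto
  then show ?thesis by simp
qed

text \<open>The witnesses \<open>u\<close>, \<open>v\<close>, \<open>w\<close> restrict the
  condition to lines with at least three points; triangles using a two-point line remain
  allowed.\<close>

locale triangle_free_line_space = line_space +
  assumes triangle: "col x y u \<Longrightarrow> col y z v \<Longrightarrow> col x z w \<Longrightarrow> col x y z"
begin

lemma strip_triangle: "(x, y) \<in> strip \<Longrightarrow> (y, z) \<in> strip \<Longrightarrow> (x, z) \<in> strip \<Longrightarrow> col x y z"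
  unfolding strip_def by (blast intro: triangle)

text \<open>A common neighbour lies on the line through \<open>x\<close> and \<open>z\<close>, and
  being joined to \<open>x\<close> it is one of the two nearest points of that line on either side
  of \<open>x\<close>.\<close>

lemma strip_codegree:
  assumes "(x, z) \<in> strip"
  shows "card {y. (x, y) \<in> strip \<and> (y, z) \<in> strip} \<le> 4"
proof -
  let ?L = "line x z"
  let ?A = "{y \<in> ?L. x < y \<and> card {w \<in> ?L. x < w \<and> w < y} \<le> 1}"
  let ?B = "{y \<in> ?L. y < x \<and> card {w \<in> ?L. y < w \<and> w < x} \<le> 1}"
  have "{y. (x, y) \<in> strip \<and> (y, z) \<in> strip} \<subseteq> ?A \<union> ?B"
  proof
    fix y assume "y \<in> {y. (x, y) \<in> strip \<and> (y, z) \<in> strip}"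
    then have y: "(x, y) \<in> strip" "(y, z) \<in> strip" by auto
    then have "col x y z" using assms strip_triangle by blast
    then have "col x z y" "y \<noteq> x" using col_rotate col_swap col_neq by metis+
    then have *: "y \<in> line x z" "y \<noteq> x" by (simp_all add: line_def)
    then have "line x y = line x z" by (rule line_eq_pivot)
    then show "y \<in> ?A \<union> ?B" using y * by (auto simp: strip_def min_def max_def split: if_splits)
  qed
  then have "card {y. (x, y) \<in> strip \<and> (y, z) \<in> strip} \<le> card (?A \<union> ?B)"
    by (rule card_mono[rotated]) (simp add: finite_line)
  also have "\<dots> \<le> card ?A + card ?B" by (rule card_Un_le)
  also have "\<dots> \<le> 2 + 2" by (intro add_mono card_near_above card_near_below finite_line)
  finally show ?thesis by simp
qed

end

text \<open>This is the decoding of the strip graph. Any three consecutive points of a line form a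
  triangle, hence are collinear for \<open>col'\<close>. Induction along the line puts every point
  on the \<open>col'\<close>-line through the two smallest points \<open>p\<close> and
  \<open>q\<close>: each further point lies on the line through its two predecessors.\<close>

lemma (in line_space) col_if_strip_triangles:
  assumes "line_space R col'"
    and tri: "\<And>x y z. (x, y) \<in> strip \<Longrightarrow> (y, z) \<in> strip \<Longrightarrow> (x, z) \<in> strip \<Longrightarrow> col' x y z"
    and xyz: "col x y z"
  shows "col' x y z"
proof -
  interpret l': line_space R col' by fact
  define L where "L = line x y"
  have fin: "finite L" by (simp add: L_def finite_line)
  have neq: "x \<noteq> y" "x \<noteq> z" "y \<noteq> z" using col_distinct[OF xyz] by simp_all
  have L: "x \<in> L" "y \<in> L" "z \<in> L" using xyz by (auto simp: L_def line_def)
  define p where "p = Min L"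
  define q where "q = Min (L - {p})"
  have p: "p \<in> L" "\<And>w. w \<in> L \<Longrightarrow> p \<le> w"
    unfolding p_def using L(1) fin by (auto intro!: Min_in)
  have "L - {p} \<noteq> {}" using L neq by auto
  then have "q \<in> L - {p}" using fin by (simp add: q_def Min_in del: Diff_iff)
  then have q: "q \<in> L" "p < q" using p by (auto simp: le_less)
  have q_le: "q \<le> w" if "w \<in> L" "w \<noteq> p" for w using that fin by (simp add: q_def)
  have sI: "(u, v) \<in> strip" if "u \<in> L" "v \<in> L" "u < v" "{w \<in> L. u < w \<and> w < v} \<subseteq> {t}" for u v t
  proof -
    have "card {w \<in> L. u < w \<and> w < v} \<le> card {t}" by (rule card_mono[OF _ that(4)]) simp
    then show ?thesis using that xyz unfolding L_def by (intro stripI[of x y z]) auto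
  qed
  have "u \<in> l'.line p q" if "u \<in> L" for u
    using that
  proof (induction u rule: less_induct)
    case (less u)
    show ?case
    proof (cases "u = p \<or> u = q")
      case False
      then have "q < u" using q_le less.prems by (metis le_neq_implies_less)
      then obtain y1 where y1: "y1 \<in> L" "y1 < u" "\<And>v. v \<in> L \<Longrightarrow> v < u \<Longrightarrow> v \<le> y1"
        using ex_previous[OF fin q(1)] by blast
      then have "p < y1" using q \<open>q < u\<close> by fastforce
      then obtain y2 where y2: "y2 \<in> L" "y2 < y1" "\<And>v. v \<in> L \<Longrightarrow> v < y1 \<Longrightarrow> v \<le> y2"
        using ex_previous[OF fin p(1)] by blast
      have "v = y1" if "v \<in> L" "y2 < v" "v < u" for v
        using y1(3)[of v] y2(3)[of v] that by (cases v y1 rule: linorder_cases) auto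
      then have "{w \<in> L. y2 < w \<and> w < y1} \<subseteq> {y1}" "{w \<in> L. y1 < w \<and> w < u} \<subseteq> {y1}"
        "{w \<in> L. y2 < w \<and> w < u} \<subseteq> {y1}"
        using y1(2) y2(2) by auto
      then have "(y2, y1) \<in> strip" "(y1, u) \<in> strip" "(y2, u) \<in> strip"
        using sI[of y2 y1 y1] sI[of y1 u y1] sI[of y2 u y1] y1(1,2) y2(1,2) less.prems by auto
      then have "u \<in> l'.line y2 y1" using tri by (auto simp: l'.line_def)
      moreover have "y2 \<in> l'.line p q" "y1 \<in> l'.line p q" using less.IH y1(1,2) y2(1,2) by auto
      ultimately show ?thesis using l'.line_eq[of y2 p q y1] y2(2) by auto
    qed (auto simp: l'.line_def)
  qed
  then show ?thesis using L neq by (intro l'.col_if_line[of x p q]) auto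
qed

subsection \<open>Contractions to rank three\<close>

text \<open>The pairs include the case \<open>x = y\<close>, so the six points are neither loops nor
  parallel. The points \<open>a\<close>, \<open>c\<close>, \<open>e\<close> are the corners and
  \<open>b\<close>, \<open>d\<close>, \<open>f\<close> the further points on the three
  lines.\<close>

definition triangle_closed :: "'a set set \<Rightarrow> bool" where
  "triangle_closed I \<longleftrightarrow> (\<forall>a b c d e f. distinct [a, b, c, d, e, f] \<longrightarrow>
     (\<forall>x\<in>{a, b, c, d, e, f}. \<forall>y\<in>{a, b, c, d, e, f}. {x, y} \<in> I) \<longrightarrow>
     {a, b, c} \<notin> I \<longrightarrow> {c, d, e} \<notin> I \<longrightarrow> {e, f, a} \<notin> I \<longrightarrow> {a, c, e} \<notin> I)"

text \<open>Extending \<open>{x, y}\<close> from an independent \<open>{y, z, w}\<close> would have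
  to add \<open>z\<close> or \<open>w\<close>, and both are excluded.\<close>

lemma dependent_triple_trans:
  assumes "matroid E I" "{x, y} \<in> I" "x \<noteq> y" "{x, y, z} \<notin> I" "{x, y, w} \<notin> I"
    and "distinct [y, z, w]"
  shows "{y, z, w} \<notin> I"
proof
  assume yzw: "{y, z, w} \<in> I"
  have "card {x, y} \<le> card {y, z, w}" using assms by simp
  then obtain Z where Z: "{x, y} \<subseteq> Z" "Z \<subseteq> {x, y} \<union> {y, z, w}" "Z \<in> I" "card Z = card {y, z, w}"
    using matroid_extend[OF assms(1,2) yzw] by blast
  have "z \<notin> Z" "w \<notin> Z" using Z(1,3) assms(4,5) matroid_subset[OF assms(1)]
    by (metis insert_subset empty_subsetI)+
  then have "card Z \<le> card {x, y}" using Z(2) by (intro card_mono) auto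
  then show False using Z(4) assms by simp
qed

lemma nat_subsets_lt_6_iff:
  fixes X :: "nat set"
  assumes "X \<subseteq> {0..<6}"
  shows "X = {0,1,2} \<longleftrightarrow> 0 \<in> X \<and> 1 \<in> X \<and> 2 \<in> X \<and> 3 \<notin> X \<and> 4 \<notin> X \<and> 5 \<notin> X"
    "X = {2,3,4} \<longleftrightarrow> 0 \<notin> X \<and> 1 \<notin> X \<and> 2 \<in> X \<and> 3 \<in> X \<and> 4 \<in> X \<and> 5 \<notin> X"
    "X = {4,5,0} \<longleftrightarrow> 0 \<in> X \<and> 1 \<notin> X \<and> 2 \<notin> X \<and> 3 \<notin> X \<and> 4 \<in> X \<and> 5 \<in> X"
    "X = {1,3,5} \<longleftrightarrow> 0 \<notin> X \<and> 1 \<in> X \<and> 2 \<notin> X \<and> 3 \<in> X \<and> 4 \<notin> X \<and> 5 \<in> X"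
proof -
  have eq: "X = Y \<longleftrightarrow> (\<forall>i\<in>S. i \<in> X \<longleftrightarrow> i \<in> Y)" if "X \<subseteq> S" "Y \<subseteq> S" for X Y S :: "nat set"
    using that by blast
  have "X \<subseteq> {0, 1, 2, 3, 4, 5}" using assms by (rule order_trans) auto
  then have *: "X = Y \<longleftrightarrow> (\<forall>i\<in>{0, 1, 2, 3, 4, 5}. i \<in> X \<longleftrightarrow> i \<in> Y)" if "Y \<subseteq> {0, 1, 2, 3, 4, 5}" for Y
    by (rule eq[OF _ that])
  show "X = {0,1,2} \<longleftrightarrow> 0 \<in> X \<and> 1 \<in> X \<and> 2 \<in> X \<and> 3 \<notin> X \<and> 4 \<notin> X \<and> 5 \<notin> X"
    "X = {2,3,4} \<longleftrightarrow> 0 \<notin> X \<and> 1 \<notin> X \<and> 2 \<in> X \<and> 3 \<in> X \<and> 4 \<in> X \<and> 5 \<notin> X"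
    "X = {4,5,0} \<longleftrightarrow> 0 \<in> X \<and> 1 \<notin> X \<and> 2 \<notin> X \<and> 3 \<notin> X \<and> 4 \<in> X \<and> 5 \<in> X"
    "X = {1,3,5} \<longleftrightarrow> 0 \<notin> X \<and> 1 \<in> X \<and> 2 \<notin> X \<and> 3 \<in> X \<and> 4 \<notin> X \<and> 5 \<in> X"
    by (subst *, simp, simp)+
qed

text \<open>With independent corners \<open>a\<close>, \<open>c\<close>, \<open>e\<close>, every
  triple other than the three lines and \<open>{b, d, f}\<close> is forced to be independent. The
  status of \<open>{b, d, f}\<close> decides between the two matroids, and the rank bound disposes
  of larger sets.\<close>

lemma matroid_iso_W3_or_K4:
  assumes m: "matroid E I" and rank: "\<And>X. X \<in> I \<Longrightarrow> card X \<le> 3"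
    and dist: "distinct [a, b, c, d, e, f]" and Q: "Q = {a, b, c, d, e, f}"
    and pairs: "\<And>x y. x \<in> Q \<Longrightarrow> y \<in> Q \<Longrightarrow> {x, y} \<in> I"
    and dep: "{a, b, c} \<notin> I" "{c, d, e} \<notin> I" "{e, f, a} \<notin> I" and ind: "{a, c, e} \<in> I"
  shows "matroid_iso Q {X \<in> I. X \<subseteq> Q} {0..<6} W3_indep \<or> matroid_iso Q {X \<in> I. X \<subseteq> Q} {0..<6} K4_indep"
proof -
  have tr: "{y, z, w} \<notin> I" if "{x, y, z} \<notin> I" "{x, y, w} \<notin> I" "distinct [x, y, z, w]" "x \<in> Q" "y \<in> Q" for x y z w
    using that(3) by (intro dependent_triple_trans[OF m pairs[OF that(4,5)] _ that(1,2)]) simp_all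
  \<comment> \<open>A point off the line \<open>{a, b, c}\<close> is independent of each pair on it.
    The letters are bound anew so that rotating them covers the other two lines.\<close>
  have off: "{a, c, p} \<in> I \<and> {a, b, p} \<in> I \<and> {b, c, p} \<in> I"
    if A: "distinct [a, b, c, d, e, f]" "{a, b, c, d, e, f} \<subseteq> Q"
      "{a, b, c} \<notin> I" "{c, d, e} \<notin> I" "{e, f, a} \<notin> I" "{a, c, e} \<in> I" "p = d \<or> p = e \<or> p = f" for a b c d e f p
  proof -
    have mem: "a \<in> Q" "b \<in> Q" "c \<in> Q" "d \<in> Q" "f \<in> Q" using A(2) by simp_all
    have d1: "distinct [d, c, a, e]" "distinct [f, a, c, e]" using A(1) by auto
    have d2: "distinct [b, a, c, p]" "distinct [b, c, a, p]" using A(1,7) by auto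
    have ab: "{b, a, c} \<notin> I" "{b, c, a} \<notin> I" using A(3) by (simp_all add: insert_commute)
    have cde: "{d, c, e} \<notin> I" and aef: "{f, a, e} \<notin> I" using A(4,5) by (simp_all add: insert_commute)
    have acp: "{a, c, p} \<in> I"
    proof (rule ccontr)
      assume np: "{a, c, p} \<notin> I"
      consider "p = d" | "p = e" | "p = f" using A(7) by blast
      then show False
      proof cases
        case 1
        then have "{d, c, a} \<notin> I" using np by (simp add: insert_commute)
        then have "{c, a, e} \<notin> I" by (rule tr[OF _ cde d1(1) mem(4,3)])
        then show False using A(6) by (simp add: insert_commute)
      next
        case 3
        then have "{f, a, c} \<notin> I" using np by (simp add: insert_commute)
        then have "{a, c, e} \<notin> I" by (rule tr[OF _ aef d1(2) mem(5,1)])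
        then show False using A(6) by simp
      qed (use np A(6) in simp)
    qed
    moreover have "{a, b, p} \<in> I"
    proof (rule ccontr)
      assume "{a, b, p} \<notin> I"
      then have "{b, a, p} \<notin> I" by (simp add: insert_commute)
      then have "{a, c, p} \<notin> I" by (rule tr[OF ab(1) _ d2(1) mem(2,1)])
      then show False using acp by simp
    qed
    moreover have "{b, c, p} \<in> I"
    proof (rule ccontr)
      assume "{b, c, p} \<notin> I"
      then have "{c, a, p} \<notin> I" by (rule tr[OF ab(2) _ d2(2) mem(2,3)])
      then show False using acp by (simp add: insert_commute)
    qed
    ultimately show ?thesis by blast
  qed
  have o1: "{a, c, p} \<in> I \<and> {a, b, p} \<in> I \<and> {b, c, p} \<in> I" if "p = d \<or> p = e \<or> p = f" for p
    by (rule off[OF dist _ dep ind that]) (simp add: Q)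
  have o2: "{c, e, p} \<in> I \<and> {c, d, p} \<in> I \<and> {d, e, p} \<in> I" if "p = f \<or> p = a \<or> p = b" for p
  proof (rule off[of c d e f a b])
    show "distinct [c, d, e, f, a, b]" "{c, d, e, f, a, b} \<subseteq> Q" using dist by (auto simp: Q)
    show "{c, e, a} \<in> I" using ind by (simp add: insert_commute)
  qed (use dep that in auto)
  have o3: "{e, a, p} \<in> I \<and> {e, f, p} \<in> I \<and> {f, a, p} \<in> I" if "p = b \<or> p = c \<or> p = d" for p
  proof (rule off[of e f a b c d])
    show "distinct [e, f, a, b, c, d]" "{e, f, a, b, c, d} \<subseteq> Q" using dist by (auto simp: Q)
    show "{e, a, c} \<in> I" using ind by (simp add: insert_commute)
  qed (use dep that in auto)
  have ind3: "{a, b, d} \<in> I" "{a, b, e} \<in> I" "{a, b, f} \<in> I" "{a, c, d} \<in> I" "{a, c, e} \<in> I" "{a, c, f} \<in> I"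
    "{a, d, e} \<in> I" "{a, d, f} \<in> I" "{b, c, d} \<in> I" "{b, c, e} \<in> I" "{b, c, f} \<in> I" "{b, d, e} \<in> I"
    "{b, e, f} \<in> I" "{c, d, f} \<in> I" "{c, e, f} \<in> I" "{d, e, f} \<in> I" "{a, b, c} \<notin> I" "{c, d, e} \<notin> I" "{a, e, f} \<notin> I"
    using o1[of d] o1[of e] o1[of f] o2[of a] o2[of b] o2[of f] o3[of b] o3[of c] o3[of d] dep ind
    by (simp_all add: insert_commute)
  have ind2: "{a} \<in> I" "{b} \<in> I" "{c} \<in> I" "{d} \<in> I" "{e} \<in> I" "{f} \<in> I"
    "{a, b} \<in> I" "{a, c} \<in> I" "{a, d} \<in> I" "{a, e} \<in> I" "{a, f} \<in> I" "{b, c} \<in> I" "{b, d} \<in> I" "{b, e} \<in> I"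
    "{b, f} \<in> I" "{c, d} \<in> I" "{c, e} \<in> I" "{c, f} \<in> I" "{d, e} \<in> I" "{d, f} \<in> I" "{e, f} \<in> I" "{} \<in> I"
    using pairs[of a a] pairs[of b b] pairs[of c c] pairs[of d d] pairs[of e e] pairs[of f f] pairs m
    by (auto simp: Q matroid_def)
  define g where "g i = [a, b, c, d, e, f] ! i" for i :: nat
  have g: "g 0 = a" "g 1 = b" "g 2 = c" "g 3 = d" "g 4 = e" "g 5 = f" "g (Suc 0) = b"
    by (simp_all add: g_def eval_nat_numeral)
  have six: "{0..<6} = {0, 1, 2, 3, 4, 5 :: nat}" by auto
  have inj: "inj_on g {0..<6}" unfolding six using dist by (auto simp: inj_on_def g)
  have bij: "bij_betw g {0..<6} Q" using inj unfolding bij_betw_def six Q by (simp add: g)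
  have *: "g ` X \<in> I \<longleftrightarrow> card X \<le> 3 \<and> X \<notin> {{0,1,2}, {2,3,4}, {4,5,0}} \<and> ({b, d, f} \<notin> I \<longrightarrow> X \<noteq> {1,3,5})"
    if X: "X \<subseteq> {0..<6}" for X
  proof (cases "card X \<le> 3")
    case False
    then have "\<not> card (g ` X) \<le> 3" using inj_on_subset[OF inj X] by (simp add: card_image)
    then show ?thesis using rank False by blast
  next
    case True
    have "X \<in> Pow {0, 1, 2, 3, 4, 5}" using X six by simp
    then show ?thesis using True
      unfolding insert_iff empty_iff nat_subsets_lt_6_iff[OF X]
      unfolding Pow_insert Pow_empty image_insert image_empty Un_insert_left Un_insert_right Un_empty_left Un_empty_right insert_iff empty_iff
      by (elim disjE; simp add: g ind2 ind3)
  qed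
  have iso: "matroid_iso Q {X \<in> I. X \<subseteq> Q} {0..<6} J"
    if "\<And>X. X \<subseteq> {0..<6} \<Longrightarrow> g ` X \<in> I \<longleftrightarrow> X \<in> J" for J
    unfolding matroid_iso_def
  proof (intro exI conjI allI impI)
    show "bij_betw (inv_into {0..<6} g) Q {0..<6}" using bij by (rule bij_betw_inv_into)
    fix X assume "X \<subseteq> Q"
    have gQ: "g ` {0..<6} = Q" using bij by (simp add: bij_betw_def)
    then have "inv_into {0..<6} g ` X \<subseteq> {0..<6}" using \<open>X \<subseteq> Q\<close> by (auto intro!: inv_into_into)
    moreover have "g ` inv_into {0..<6} g ` X = X" using gQ \<open>X \<subseteq> Q\<close> by (rule image_inv_into_cancel)
    ultimately have "X \<in> I \<longleftrightarrow> inv_into {0..<6} g ` X \<in> J" using that[of "inv_into {0..<6} g ` X"] by simp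
    then show "X \<in> {X \<in> I. X \<subseteq> Q} \<longleftrightarrow> inv_into {0..<6} g ` X \<in> J" using \<open>X \<subseteq> Q\<close> by simp
  qed
  show ?thesis
  proof (cases "{b, d, f} \<in> I")
    case True
    then have "matroid_iso Q {X \<in> I. X \<subseteq> Q} {0..<6} W3_indep" using * by (intro iso) (simp add: W3_indep_def)
    then show ?thesis ..
  next
    case False
    then have "matroid_iso Q {X \<in> I. X \<subseteq> Q} {0..<6} K4_indep" using * by (intro iso) (auto simp: K4_indep_def)
    then show ?thesis ..
  qed
qed

text \<open>Used for independent \<open>T\<close> only. Then \<open>T\<close> is the sole maximal
  independent subset of itself, so the quantified \<open>B\<close> in \<open>is_minor\<close>
  reduces to \<open>T\<close>.\<close>

definition contract :: "'a set \<Rightarrow> 'a set set \<Rightarrow> 'a set \<Rightarrow> 'a set set" where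
  "contract E I T = {X. X \<subseteq> E - T \<and> X \<union> T \<in> I}"

lemma matroid_contract:
  assumes "matroid E I" "T \<in> I"
  shows "matroid (E - T) (contract E I T)"
proof -
  have sub: "X \<in> I" if "Y \<in> I" "X \<subseteq> Y" for X Y using assms that by (blast intro: matroid_subset)
  show ?thesis
    unfolding matroid_def
    proof (intro conjI allI impI)
      show "finite (E - T)" using assms by (simp add: matroid_def)
      show "contract E I T \<subseteq> Pow (E - T)" "{} \<in> contract E I T" using assms by (auto simp: contract_def)
      show "X \<in> contract E I T" if "Y \<in> contract E I T \<and> X \<subseteq> Y" for X Y
        using that sub[of "Y \<union> T" "X \<union> T"] by (auto simp: contract_def)
      fix X Y assume XY: "X \<in> contract E I T \<and> Y \<in> contract E I T \<and> card X < card Y"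
      then have "finite (X \<union> T)" "finite (Y \<union> T)" using matroid_finite[OF assms(1)] by (auto simp only: contract_def mem_Collect_eq)
      then have "card (X \<union> T) < card (Y \<union> T)"
        using XY by (subst (1 2) card_Un_disjoint) (auto simp: contract_def)
      then obtain y where y: "y \<in> (Y \<union> T) - (X \<union> T)" "insert y (X \<union> T) \<in> I"
        using XY matroid_augment[OF assms(1), of "X \<union> T" "Y \<union> T"] by (auto simp: contract_def)
      then have "y \<in> Y - X" "insert y X \<in> contract E I T" using XY by (auto simp: contract_def)
      then show "\<exists>y\<in>Y - X. insert y X \<in> contract E I T" by blast
    qed
qed

lemma is_minor_contract:
  assumes "matroid E I" "T \<in> I" "Q \<subseteq> E - T"
  shows "is_minor Q {X \<in> contract E I T. X \<subseteq> Q} E I"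
  unfolding is_minor_def
proof (intro exI conjI)
  have "T \<subseteq> E" using assms by (auto simp: matroid_def)
  then show "T \<subseteq> E" "E - T - Q \<subseteq> E" "T \<inter> (E - T - Q) = {}" "Q = E - (T \<union> (E - T - Q))"
    using assms by auto
  have "B = T" if B: "B \<subseteq> T" "\<forall>x\<in>T - B. insert x B \<notin> I" for B
  proof (rule ccontr)
    assume "B \<noteq> T"
    then obtain x where x: "x \<in> T - B" using B(1) by blast
    then have "insert x B \<in> I" using matroid_subset[OF assms(1,2)] B(1) by simp
    then show False using B(2) x by blast
  qed
  then show "{X \<in> contract E I T. X \<subseteq> Q} =
    {X. X \<subseteq> Q \<and> (\<exists>B. B \<subseteq> T \<and> B \<in> I \<and> (\<forall>x\<in>T - B. insert x B \<notin> I) \<and> X \<union> B \<in> I)}"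
    using assms unfolding contract_def by blast
qed

lemma triangle_closed_contract:
  fixes E :: "'a set"
  assumes "matroid E I" "T \<in> I" and rank: "\<And>X. X \<in> contract E I T \<Longrightarrow> card X \<le> 3"
    and "\<not> has_minor_iso E I {0..<6} W3_indep" "\<not> has_minor_iso E I {0..<6} K4_indep"
  shows "triangle_closed (contract E I T)"
  unfolding triangle_closed_def
proof (intro allI impI notI)
  fix a b c d e f :: 'a
  let ?Q = "{a, b, c, d, e, f}" and ?J = "contract E I T"
  assume d: "distinct [a, b, c, d, e, f]" and p: "\<forall>x\<in>?Q. \<forall>y\<in>?Q. {x, y} \<in> ?J"
    and t: "{a, b, c} \<notin> ?J" "{c, d, e} \<notin> ?J" "{e, f, a} \<notin> ?J" "{a, c, e} \<in> ?J"
  have p': "\<And>x y. x \<in> ?Q \<Longrightarrow> y \<in> ?Q \<Longrightarrow> {x, y} \<in> ?J" using p by blast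
  have "\<And>x. x \<in> ?Q \<Longrightarrow> x \<in> E - T" using p' by (auto simp: contract_def)
  then have "?Q \<subseteq> E - T" by (rule subsetI)
  then have "is_minor ?Q {X \<in> ?J. X \<subseteq> ?Q} E I" using assms by (intro is_minor_contract)
  then show False
    using matroid_iso_W3_or_K4[OF matroid_contract[OF assms(1,2)] rank d refl p' t] assms(4,5)
    unfolding has_minor_iso_def by blast
qed

subsection \<open>Counting matroids of rank three\<close>

definition parallel :: "'a set set \<Rightarrow> 'a \<Rightarrow> 'a \<Rightarrow> bool" where
  "parallel I x y \<longleftrightarrow> {x} \<in> I \<and> {y} \<in> I \<and> (x = y \<or> {x, y} \<notin> I)"

text \<open>The least element is a canonical choice, so \<open>rep\<close> is determined by the
  parallel classes. On a loop no element qualifies and the value is unspecified.\<close>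

definition rep :: "nat set set \<Rightarrow> nat \<Rightarrow> nat" where
  "rep I x = (LEAST y. parallel I x y)"

definition reps :: "nat set set \<Rightarrow> nat set" where
  "reps I = {x. {x} \<in> I \<and> rep I x = x}"

lemma parallel_sym: "parallel I x y \<Longrightarrow> parallel I y x"
  by (auto simp: parallel_def insert_commute)

lemma parallel_trans:
  assumes "matroid E I" "parallel I x y" "parallel I y z"
  shows "parallel I x z"
proof (cases "x = y \<or> y = z \<or> x = z")
  case False
  have "{x, z} \<notin> I"
  proof
    assume xz: "{x, z} \<in> I"
    have "{y} \<in> I" using assms(2) by (simp add: parallel_def)
    moreover have "card {y} < card {x, z}" using False by simp
    ultimately have "\<exists>u\<in>{x, z} - {y}. {u, y} \<in> I" using matroid_augment[OF assms(1) _ xz] by blast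
    then show False using assms(2,3) False by (auto simp: parallel_def insert_commute)
  qed
  then show ?thesis using assms by (simp add: parallel_def)
qed (use assms in \<open>auto simp: parallel_def\<close>)

lemma parallel_rep: "{x} \<in> I \<Longrightarrow> parallel I x (rep I x)"
  unfolding rep_def by (rule LeastI[of _ x]) (simp add: parallel_def)

lemma rep_eq_iff:
  assumes "matroid E I" "{x} \<in> I" "{y} \<in> I"
  shows "rep I x = rep I y \<longleftrightarrow> parallel I x y"
proof
  assume "rep I x = rep I y"
  then show "parallel I x y"
    using parallel_rep[OF assms(2)] parallel_rep[OF assms(3)] parallel_sym parallel_trans[OF assms(1)] by metis
next
  assume "parallel I x y"
  then have "parallel I x z \<longleftrightarrow> parallel I y z" for z
    using parallel_trans[OF assms(1), of x y z] parallel_trans[OF assms(1), of y x z] parallel_sym[of I x y] by blast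
  then show "rep I x = rep I y" by (simp add: rep_def)
qed

lemma rep_in_reps: "matroid E I \<Longrightarrow> {x} \<in> I \<Longrightarrow> rep I x \<in> reps I"
  using parallel_rep[of x I] rep_eq_iff[of E I "rep I x" x]
  by (auto simp: reps_def parallel_def insert_commute)

lemma pair_in_if_reps:
  assumes "matroid E I" "x \<in> reps I" "y \<in> reps I" shows "{x, y} \<in> I"
  using rep_eq_iff[OF assms(1), of x y] assms by (cases "x = y") (auto simp: reps_def parallel_def)

lemma reps_subset: "matroid E I \<Longrightarrow> reps I \<subseteq> E"
  unfolding reps_def matroid_def by blast

lemma indep_replace_parallel:
  assumes m: "matroid E I" and "X \<in> I" "x \<in> X" "parallel I x y"
  shows "insert y (X - {x}) \<in> I"
proof (cases "x = y")
  case True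
  then show ?thesis using assms by (simp add: insert_absorb)
next
  case False
  then have xy: "{y} \<in> I" "{x, y} \<notin> I" using assms(4) by (auto simp: parallel_def)
  have finX: "finite X" using m assms(2) by (rule matroid_finite)
  have "y \<notin> X" using xy(2) matroid_subset[OF m \<open>X \<in> I\<close>, of "{x, y}"] assms(3) by auto
  have "card {y} \<le> card X" using finX assms(3) by (auto simp: Suc_le_eq card_gt_0_iff)
  then obtain Z where Z: "{y} \<subseteq> Z" "Z \<subseteq> {y} \<union> X" "Z \<in> I" "card Z = card X"
    using matroid_extend[OF m xy(1) \<open>X \<in> I\<close>] by blast
  have "x \<notin> Z" using Z(1,3) xy(2) matroid_subset[OF m Z(3), of "{x, y}"] by auto
  then have "Z \<subseteq> insert y (X - {x})" using Z(2) by auto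
  moreover have "card (insert y (X - {x})) = card X"
    using finX \<open>y \<notin> X\<close> card_Suc_Diff1[OF finX assms(3)] by simp
  ultimately have "Z = insert y (X - {x})" using finX Z(4) by (intro card_seteq) auto
  then show ?thesis using Z(3) by simp
qed

lemma indep_inj_on_rep:
  assumes m: "matroid E I" and "X \<in> I"
  shows "X \<subseteq> {x. {x} \<in> I}" "inj_on (rep I) X"
proof -
  show s: "X \<subseteq> {x. {x} \<in> I}" using matroid_subset[OF assms] by auto
  show "inj_on (rep I) X"
  proof (rule inj_onI)
    fix x y assume xy: "x \<in> X" "y \<in> X" "rep I x = rep I y"
    then have "parallel I x y" using rep_eq_iff[OF m] s by blast
    moreover have "{x, y} \<in> I" using matroid_subset[OF assms] xy by simp
    ultimately show "x = y" by (simp add: parallel_def)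
  qed
qed

text \<open>Elements are exchanged for their representatives one at a time, by induction on how many
  are not yet representatives. Injectivity prevents two elements from merging.\<close>

lemma indep_iff_rep_image:
  assumes m: "matroid E I" and "finite X" "X \<subseteq> {x. {x} \<in> I}" "inj_on (rep I) X"
  shows "X \<in> I \<longleftrightarrow> rep I ` X \<in> I"
  using assms(2-)
proof (induction "card (X - reps I)" arbitrary: X)
  case 0
  then have "\<And>x. x \<in> X \<Longrightarrow> rep I x = x" by (auto simp: reps_def)
  then show ?case by simp
next
  case (Suc k)
  then obtain x where x: "x \<in> X" "x \<notin> reps I" by (metis DiffE card_eq_0_iff ex_in_conv nat.distinct(1))
  define y where "y = rep I x"
  define Y where "Y = insert y (X - {x})"
  have par: "parallel I x y" unfolding y_def using x Suc.prems by (intro parallel_rep) auto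
  have y: "y \<in> reps I" "{y} \<in> I" "rep I y = rep I x" "y \<noteq> x"
    using rep_in_reps[OF m, of x] x Suc.prems by (auto simp: y_def reps_def)
  then have "y \<notin> X" using Suc.prems(3) x by (auto dest: inj_onD)
  have image: "rep I ` Y = rep I ` X" using x y(3) by (auto simp: Y_def)
  have "Y - reps I = (X - reps I) - {x}" using y(1) by (auto simp: Y_def)
  then have "k = card (Y - reps I)" using Suc.hyps(2) Suc.prems(1) x by simp
  moreover have "inj_on (rep I) Y"
    using Suc.prems(3) x y(3) unfolding Y_def by (auto simp: inj_on_def)
  ultimately have "Y \<in> I \<longleftrightarrow> rep I ` X \<in> I"
    using Suc.hyps(1)[of Y] Suc.prems y(2) image by (auto simp: Y_def)
  moreover have "X = insert x (Y - {y})" using x y(4) \<open>y \<notin> X\<close> by (auto simp: Y_def)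
  then have "Y \<in> I \<longleftrightarrow> X \<in> I"
    using indep_replace_parallel[OF m _ x(1) par] indep_replace_parallel[OF m _ _ parallel_sym[OF par], of Y]
    unfolding Y_def by (metis insertI1)
  ultimately show ?case by simp
qed

definition collinear :: "nat set set \<Rightarrow> nat \<Rightarrow> nat \<Rightarrow> nat \<Rightarrow> bool" where
  "collinear I x y z \<longleftrightarrow> {x, y, z} \<subseteq> reps I \<and> distinct [x, y, z] \<and> {x, y, z} \<notin> I"

lemma line_space_collinear:
  assumes m: "matroid E I"
  shows "line_space (reps I) (collinear I)"
proof
  show "finite (reps I)" using reps_subset[OF m] m by (auto simp: matroid_def intro: finite_subset)
  fix x y z w assume xy: "collinear I x y z" "collinear I x y w" "z \<noteq> w"
  have "{x, y} \<in> I" using xy by (intro pair_in_if_reps[OF m]) (simp_all add: collinear_def)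
  then have "{y, z, w} \<notin> I"
    by (rule dependent_triple_trans[OF m]) (use xy in \<open>simp_all add: collinear_def\<close>)
  then show "collinear I y z w" using xy by (simp add: collinear_def)
qed (auto simp: collinear_def insert_commute)

text \<open>If the corners were not collinear, the three lines would be distinct, so any coincidence
  among the corners and the further points \<open>u\<close>, \<open>v\<close>, \<open>w\<close>
  would give two lines two common points. The six points are therefore distinct and
  \<open>triangle_closed\<close> applies.\<close>

lemma triangle_free_collinear:
  assumes m: "matroid E I" and "triangle_closed I"
  shows "triangle_free_line_space (reps I) (collinear I)"
proof -
  interpret line_space "reps I" "collinear I" by (rule line_space_collinear[OF m])
  show ?thesis
  proof
    fix x y z u v w
    assume xyz: "collinear I x y u" "collinear I y z v" "collinear I x z w"
    show "collinear I x y z"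
    proof (rule ccontr)
      assume not: "\<not> collinear I x y z"
      have perm: "collinear I a b c \<Longrightarrow> collinear I b a c \<and> collinear I c b a \<and> collinear I a c b" for a b c
        using col_swap col_rotate by metis
      have "u \<noteq> z" "v \<noteq> x" "w \<noteq> y" using xyz not perm by metis+
      moreover have "u \<noteq> v" "u \<noteq> w" "v \<noteq> w"
        using xyz not perm col_trans[of u y x z] col_trans[of u x y z] col_trans[of v z y x] col_distinct by metis+
      moreover have "x \<noteq> y \<and> x \<noteq> u \<and> y \<noteq> u" "y \<noteq> z \<and> y \<noteq> v \<and> z \<noteq> v" "x \<noteq> z \<and> x \<noteq> w \<and> z \<noteq> w"
        using xyz by (auto simp: collinear_def)
      ultimately have dist: "distinct [x, u, y, v, z, w]" by auto
      have mem: "{x, u, y, v, z, w} \<subseteq> reps I" using xyz by (simp add: collinear_def)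
      have dep: "{x, u, y} \<notin> I" "{y, v, z} \<notin> I" "{z, w, x} \<notin> I"
        using xyz by (simp_all add: collinear_def insert_commute)
      have "{x, y, z} \<notin> I"
        using assms(2)[unfolded triangle_closed_def, rule_format, OF dist _ dep] pair_in_if_reps[OF m] mem by blast
      then show False using not mem dist by (simp add: collinear_def)
    qed
  qed
qed

text \<open>Injectivity of the encoding. The strip graph determines collinearity, hence independence
  among representatives; loops and representatives extend this to all sets.\<close>

lemma matroid_rank3_eqI:
  assumes I: "matroid E I" "\<And>X. X \<in> I \<Longrightarrow> card X \<le> 3" "triangle_closed I"
    and J: "matroid E J" "\<And>X. X \<in> J \<Longrightarrow> card X \<le> 3" "triangle_closed J"
    and loops: "{x. {x} \<in> I} = {x. {x} \<in> J}"
    and rep: "\<And>x. {x} \<in> I \<Longrightarrow> rep I x = rep J x"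
    and strip: "line_space.strip (collinear I) = line_space.strip (collinear J)"
  shows "I = J"
proof -
  have nl: "{x} \<in> I \<longleftrightarrow> {x} \<in> J" for x using loops by blast
  have reps: "reps I = reps J" using nl rep by (auto simp: reps_def)
  interpret i: triangle_free_line_space "reps I" "collinear I" by (rule triangle_free_collinear[OF I(1,3)])
  interpret j: triangle_free_line_space "reps I" "collinear J" unfolding reps by (rule triangle_free_collinear[OF J(1,3)])
  have col: "collinear I x y z \<longleftrightarrow> collinear J x y z" for x y z
    using i.col_if_strip_triangles[OF j.line_space_axioms] j.col_if_strip_triangles[OF i.line_space_axioms]
      i.strip_triangle j.strip_triangle strip by metis
  have Y: "Y \<in> I \<longleftrightarrow> Y \<in> J" if "Y \<subseteq> reps I" for Y
  proof -
    have "finite Y" using that i.finite_R finite_subset by blast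
    consider "card Y = 0" | "card Y = 1" | "card Y = 2" | "card Y = 3" | "3 < card Y" by linarith
    then show ?thesis
    proof cases
      case 1
      then show ?thesis using \<open>finite Y\<close> I(1) J(1) by (simp add: matroid_def)
    next
      case 2
      then show ?thesis using nl by (auto simp: card_1_singleton_iff)
    next
      case 3
      then obtain x y where "Y = {x, y}" by (auto simp: card_2_iff)
      then show ?thesis using pair_in_if_reps[OF I(1)] pair_in_if_reps[OF J(1)] that reps by auto
    next
      case 4
      then obtain x y z where xyz: "Y = {x, y, z}" "distinct [x, y, z]" by (auto simp: card_3_iff)
      then have "Y \<in> K \<longleftrightarrow> \<not> collinear K x y z" if "reps K = reps I" for K
        using that \<open>Y \<subseteq> reps I\<close> by (simp add: collinear_def)
      then show ?thesis using col reps by metis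
    next
      case 5
      then show ?thesis using I(2) J(2) by (meson not_le)
    qed
  qed
  have sub: "K \<subseteq> K'" if K: "matroid E K" "matroid E K'" and nl: "\<And>x. {x} \<in> K \<longleftrightarrow> {x} \<in> K'"
    and rep: "\<And>x. {x} \<in> K \<Longrightarrow> rep K x = rep K' x" and Y: "\<And>Y. Y \<subseteq> reps K \<Longrightarrow> Y \<in> K \<longleftrightarrow> Y \<in> K'" for K K'
  proof
    fix X assume X: "X \<in> K"
    then have X1: "X \<subseteq> {x. {x} \<in> K}" "inj_on (rep K) X" "finite X"
      using indep_inj_on_rep[OF K(1)] matroid_finite[OF K(1)] by blast+
    have eq: "rep K' ` X = rep K ` X" "inj_on (rep K') X"
      using X1 rep by (auto intro!: image_cong simp: inj_on_def subset_iff)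
    have "rep K ` X \<in> K" using indep_iff_rep_image[OF K(1) X1(3,1,2)] X by simp
    moreover have "rep K ` X \<subseteq> reps K" using X1(1) rep_in_reps[OF K(1)] by auto
    ultimately have "rep K' ` X \<in> K'" using Y eq by simp
    then show "X \<in> K'" using indep_iff_rep_image[OF K(2) X1(3) _ eq(2)] X1(1) nl by auto
  qed
  show ?thesis
  proof
    show "I \<subseteq> J" by (rule sub[OF I(1) J(1) nl rep Y])
    show "J \<subseteq> I" by (rule sub[OF J(1) I(1)]) (use nl rep Y reps in auto)
  qed
qed

section \<open>The number of encodings\<close>

lemma few_small_subsets:
  fixes d :: real
  assumes "0 < d"
  shows "\<exists>e::real. 0 < e \<and> (\<forall>S :: 'a set. finite S \<longrightarrow> card {A. A \<subseteq> S \<and> card A \<le> e * card S} \<le> exp (d * card S))"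
proof -
  define x where "x = min (d / 2) 1"
  \<comment> \<open>Weighting each subset by a power of \<open>x\<close> bounds the count by
    \<open>exp (x * card S) / x powr (e * card S)\<close>. This \<open>e\<close> gives
    \<open>- e * ln x\<close> at most \<open>d / 2\<close>, the share left by \<open>x\<close>; the
    summand 1 keeps the denominator positive when \<open>x = 1\<close>.\<close>
  define e where "e = d / 2 / (1 - ln x)"
  have x: "0 < x" "x \<le> 1" "x \<le> d / 2" using assms by (auto simp: x_def)
  have "ln x \<le> 0" using x by simp
  then have lx: "0 < 1 - ln x" by linarith
  have "0 < e" using assms lx by (simp add: e_def)
  have "card {A. A \<subseteq> S \<and> card A \<le> e * card S} \<le> exp (d * card S)" if "finite S" for S :: "'a set"
  proof -
    let ?k = "e * card S" and ?F = "{A. A \<subseteq> S \<and> card A \<le> e * card S}"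
    have "x powr ?k * card ?F = (\<Sum>A\<in>?F. x powr ?k)" by simp
    also have "\<dots> \<le> (\<Sum>A\<in>?F. x ^ card A)"
    proof (rule sum_mono)
      fix A assume "A \<in> ?F"
      then show "x powr ?k \<le> x ^ card A" using x by (simp add: powr_mono' flip: powr_realpow)
    qed
    also have "\<dots> \<le> (\<Sum>A\<in>Pow S. x ^ card A)" using that x by (intro sum_mono2) auto
    also have "\<dots> = (1 + x) ^ card S"
      using prod_add[OF that, of "\<lambda>_. x" "\<lambda>_. 1"] by (simp add: add.commute)
    also have "\<dots> \<le> exp x ^ card S" using x by (intro power_mono) auto
    also have "\<dots> = exp (x * card S)" using exp_of_nat_mult[of "card S" x] by (simp add: mult.commute)
    finally have "card ?F \<le> exp (x * card S) / x powr ?k" using x by (simp add: field_simps)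
    also have "\<dots> = exp (x * card S - ?k * ln x)" using x by (simp add: powr_def exp_diff)
    also have "\<dots> \<le> exp (d * card S)"
    proof -
      have "- e * ln x \<le> e * (1 - ln x)" using \<open>0 < e\<close> by (simp add: algebra_simps)
      also have "\<dots> = d / 2" using lx unfolding e_def by (metis less_irrefl nonzero_eq_divide_eq)
      finally have "x + - e * ln x \<le> d" using x(3) by linarith
      then have "(x + - e * ln x) * card S \<le> d * card S" by (rule mult_right_mono) simp
      then show ?thesis by (simp add: algebra_simps)
    qed
    finally show ?thesis .
  qed
  then show ?thesis using \<open>0 < e\<close> by (intro exI[of _ e]) simp
qed

definition rank3_class :: "nat set \<Rightarrow> nat set set set" where
  "rank3_class E = {I. matroid E I \<and> (\<forall>X\<in>I. card X \<le> 3) \<and> triangle_closed I}"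

theorem card_rank3_class:
  fixes d :: real
  assumes "0 < d"
  shows "\<exists>n0. \<forall>E. finite E \<longrightarrow> n0 \<le> card E \<longrightarrow> card (rank3_class E) \<le> exp (d * (card E)\<^sup>2)"
proof -
  obtain e :: real where e: "0 < e"
    and few: "\<And>S :: (nat \<times> nat) set. finite S \<Longrightarrow> card {A. A \<subseteq> S \<and> card A \<le> e * card S} \<le> exp (d / 2 * card S)"
    using few_small_subsets[of "d / 2"] assms by auto
  obtain n1 where n1': "\<forall>(V :: nat set) G. finite V \<longrightarrow> n1 \<le> card V \<longrightarrow> G \<subseteq> V \<times> V \<longrightarrow> sym G \<longrightarrow>
    (\<forall>(x, y) \<in> G. \<exists>z. (x, z) \<in> G \<and> (y, z) \<in> G) \<longrightarrow>
    (\<forall>(x, z) \<in> G. card {y. (x, y) \<in> G \<and> (y, z) \<in> G} \<le> 4) \<longrightarrow> card G \<le> e * (card V)\<^sup>2"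
    using few_edges_if_few_triangles_per_edge[OF e, of 4, where 'a = nat] by (elim exE)
  note n1 = n1'[THEN spec, THEN spec, THEN mp, THEN mp, THEN mp, THEN mp, THEN mp, THEN mp]
  have "\<forall>\<^sub>F n in sequentially. ln (2 * real n) / (2 * real n) < d / 4"
  proof -
    have "filterlim (\<lambda>n. 2 * real n) at_top sequentially"
      by (rule filterlim_tendsto_pos_mult_at_top[OF tendsto_const _ filterlim_real_sequentially]) simp
    then have "(\<lambda>n. ln (2 * real n) / (2 * real n)) \<longlonglongrightarrow> 0"
      by (rule filterlim_compose[OF ln_x_over_x_tendsto_0])
    then show ?thesis using assms by (intro order_tendstoD(2)) auto
  qed
  then obtain n2 where n2: "\<And>n. n2 \<le> n \<Longrightarrow> ln (2 * real n) / (2 * real n) < d / 4"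
    by (auto simp: eventually_sequentially)
  define n0 where "n0 = Suc (n1 + n2 + nat \<lceil>(real n1)\<^sup>2 / e\<rceil>)"
  have "card (rank3_class E) \<le> exp (d * (card E)\<^sup>2)" if E: "finite E" "n0 \<le> card E" for E
  proof -
    let ?n = "card E"
    let ?S = "{A. A \<subseteq> E \<times> E \<and> card A \<le> e * card (E \<times> E)}"
    \<comment> \<open>Loops are sent to themselves so that the second component always maps
      \<open>E\<close> into \<open>E\<close>.\<close>
    let ?code = "\<lambda>I. ({x. {x} \<in> I}, \<lambda>x\<in>E. if {x} \<in> I then rep I x else x, line_space.strip (collinear I))"
    have cardEE: "real (card (E \<times> E)) = (real ?n)\<^sup>2" by (simp add: card_cartesian_product power2_eq_square)
    have code: "?code ` rank3_class E \<subseteq> Pow E \<times> (E \<rightarrow>\<^sub>E E) \<times> ?S"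
    proof (rule image_subsetI)
      fix I assume "I \<in> rank3_class E"
      then have m: "matroid E I" and tc: "triangle_closed I" by (auto simp: rank3_class_def)
      interpret triangle_free_line_space "reps I" "collinear I" by (rule triangle_free_collinear[OF m tc])
      have nl: "{x. {x} \<in> I} \<subseteq> E" using m by (auto simp: matroid_def)
      have "rep I x \<in> E" if "{x} \<in> I" for x using rep_in_reps[OF m that] reps_subset[OF m] by blast
      then have "(\<lambda>x\<in>E. if {x} \<in> I then rep I x else x) \<in> E \<rightarrow>\<^sub>E E" by auto
      moreover have sub: "strip \<subseteq> reps I \<times> reps I" by (rule strip_subset)
      have "card strip \<le> e * (card E)\<^sup>2"
      \<comment> \<open>After simplification few points may remain even when \<open>E\<close> is
        large. Then the graph has at most \<open>n1\<^sup>2\<close> edges, and the last summand of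
        \<open>n0\<close> makes this small enough.\<close>
      proof (cases "n1 \<le> card (reps I)")
        case True
        have "card strip \<le> e * (card (reps I))\<^sup>2"
          using strip_in_triangle strip_codegree by (intro n1[OF finite_R True sub sym_strip]) auto
        also have "\<dots> \<le> e * (card E)\<^sup>2"
          using e card_mono[OF E(1) reps_subset[OF m]] by (intro mult_left_mono of_nat_mono power_mono) auto
        finally show ?thesis .
      next
        case False
        have "card strip \<le> card (reps I \<times> reps I)" using sub finite_R by (intro card_mono) auto
        also have "\<dots> \<le> n1 * n1" using False by (simp add: card_cartesian_product mult_mono)
        finally have "real (card strip) \<le> (real n1)\<^sup>2" by (simp add: power2_eq_square flip: of_nat_mult)
        also have "(real n1)\<^sup>2 / e \<le> real n0" unfolding n0_def by linarith
        then have "(real n1)\<^sup>2 \<le> e * n0" using e by (simp add: field_simps)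
        also have "e * n0 \<le> e * (card E)\<^sup>2"
        proof (intro mult_left_mono of_nat_mono)
          show "n0 \<le> (card E)\<^sup>2" using E(2) by (simp add: power2_eq_square le_trans[OF _ le_square])
        qed (use e in simp)
        finally show ?thesis by simp
      qed
      moreover have "strip \<subseteq> E \<times> E" using sub reps_subset[OF m] by blast
      ultimately show "?code I \<in> Pow E \<times> (E \<rightarrow>\<^sub>E E) \<times> ?S"
        using nl cardEE by simp
    qed
    have finS: "finite ?S" using E(1) by (intro finite_subset[of ?S "Pow (E \<times> E)"]) auto
    have "finite (Pow E \<times> (E \<rightarrow>\<^sub>E E) \<times> ?S)"
      using E(1) finS by (intro finite_cartesian_product finite_PiE) auto
    moreover have "inj_on ?code (rank3_class E)"
    proof (rule inj_onI)
      fix I J assume IJ: "I \<in> rank3_class E" "J \<in> rank3_class E" "?code I = ?code J"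
      have "rep I x = rep J x" if "{x} \<in> I" for x
      proof -
        have "x \<in> E" using that IJ(1) by (auto simp: rank3_class_def matroid_def)
        moreover have "{x} \<in> J" using that IJ(3) by blast
        ultimately show ?thesis using that IJ(3) by (auto dest!: fun_cong[where x = x])
      qed
      then show "I = J" using IJ by (intro matroid_rank3_eqI[of E I J]) (auto simp: rank3_class_def)
    qed
    ultimately have "card (rank3_class E) \<le> card (Pow E \<times> (E \<rightarrow>\<^sub>E E) \<times> ?S)"
      using code by (intro card_inj_on_le)
    also have "\<dots> = 2 ^ ?n * ?n ^ ?n * card ?S"
      using E(1) by (simp add: card_cartesian_product card_Pow card_PiE)
    finally have "real (card (rank3_class E)) \<le> real (2 ^ ?n * ?n ^ ?n * card ?S)"
      by (simp only: of_nat_le_iff)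
    also have "\<dots> = (2 * real ?n) ^ ?n * card ?S" by (simp add: power_mult_distrib)
    also have "\<dots> \<le> exp (d / 2 * ?n\<^sup>2) * exp (d / 2 * ?n\<^sup>2)"
    proof (intro mult_mono)
      have n: "0 < ?n" "n2 \<le> ?n" using E(2) by (auto simp: n0_def)
      have "ln (2 * real ?n) \<le> d / 2 * ?n" using n2[OF n(2)] n(1) by (simp add: field_simps)
      then have "?n * ln (2 * real ?n) \<le> ?n * (d / 2 * ?n)" by (rule mult_left_mono) simp
      then have "ln ((2 * real ?n) ^ ?n) \<le> d / 2 * ?n\<^sup>2"
        using n ln_realpow[of "2 * real ?n" ?n] by (simp only: power2_eq_square mult_ac of_nat_mult)
      then show "(2 * real ?n) ^ ?n \<le> exp (d / 2 * ?n\<^sup>2)"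
        using n by (subst ln_le_cancel_iff[symmetric]) auto
      show "real (card ?S) \<le> exp (d / 2 * ?n\<^sup>2)" using few[of "E \<times> E"] E(1) cardEE by simp
    qed auto
    also have "\<dots> = exp (d * ?n\<^sup>2)" by (simp flip: exp_add)
    finally show ?thesis .
  qed
  then show ?thesis by blast
qed

subsection \<open>Counting matroids of arbitrary rank\<close>

definition W3_K4_free :: "nat \<Rightarrow> nat \<Rightarrow> nat set set set" where
  "W3_K4_free n r = {I. matroid {1..n} I \<and>
      \<not> has_minor_iso {1..n} I {0..<6} W3_indep \<and> \<not> has_minor_iso {1..n} I {0..<6} K4_indep \<and>
      (\<exists>B\<in>I. card B = r) \<and> (\<forall>X\<in>I. card X \<le> r)}"

definition bases :: "nat \<Rightarrow> 'a set set \<Rightarrow> 'a set set" where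
  "bases r I = {B \<in> I. card B = r}"

lemma finite_W3_K4_free: "finite (W3_K4_free n r)"
  unfolding W3_K4_free_def by (rule finite_indep_families)

lemma bases_subset: "I \<in> W3_K4_free n r \<Longrightarrow> bases r I \<subseteq> {B. B \<subseteq> {1..n} \<and> card B = r}"
  by (auto simp: W3_K4_free_def matroid_def bases_def)

lemma inj_on_bases: "inj_on (bases r) (W3_K4_free n r)"
proof (rule inj_onI)
  have *: "X \<in> I \<longleftrightarrow> (\<exists>B\<in>bases r I. X \<subseteq> B)" if I: "I \<in> W3_K4_free n r" for I X
  proof
    have m: "matroid {1..n} I" using I by (simp add: W3_K4_free_def)
    show "X \<in> I" if "\<exists>B\<in>bases r I. X \<subseteq> B" using that matroid_subset[OF m] by (auto simp: bases_def)
    assume X: "X \<in> I"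
    obtain B where B: "B \<in> I" "card B = r" using I by (auto simp: W3_K4_free_def)
    have "card X \<le> card B" using I X B(2) by (auto simp: W3_K4_free_def)
    then obtain Z where "X \<subseteq> Z" "Z \<in> I" "card Z = card B" using matroid_extend[OF m X B(1)] by blast
    then show "\<exists>B\<in>bases r I. X \<subseteq> B" using B(2) by (auto simp: bases_def)
  qed
  fix I J assume I: "I \<in> W3_K4_free n r" and J: "J \<in> W3_K4_free n r" and "bases r I = bases r J"
  then show "I = J" using *[OF I] *[OF J] by (intro set_eqI) simp
qed

lemma card_W3_K4_free_le: "card (W3_K4_free n r) \<le> 2 ^ (n choose r)"
proof -
  let ?V = "{B. B \<subseteq> {1..n} \<and> card B = r}"
  have "card (W3_K4_free n r) \<le> card (Pow ?V)"
    using bases_subset by (intro card_inj_on_le[OF inj_on_bases]) (blast, simp)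
  also have "\<dots> = 2 ^ (n choose r)" by (simp add: card_Pow n_subsets)
  finally show ?thesis .
qed

lemma finite_rank3_class: "finite (rank3_class E)"
proof (cases "finite E")
  case True
  have "rank3_class E \<subseteq> Pow (Pow E)"
    unfolding rank3_class_def matroid_def by (intro subsetI) (simp only: mem_Collect_eq Pow_iff)
  then show ?thesis using True by (simp add: finite_subset)
next
  case False
  then have "rank3_class E = {}" by (simp add: rank3_class_def matroid_def)
  then show ?thesis by simp
qed

text \<open>The bases containing \<open>T\<close> are the 3-element independent sets of the
  contraction with \<open>T\<close> added back. The summand 1 counts the empty trace left by
  matroids in which \<open>T\<close> is dependent.\<close>

lemma card_traces_le:
  assumes "T \<subseteq> {1..n}" "card T + 3 = r"
  shows "card ((\<lambda>A. A \<inter> {B. T \<subseteq> B}) ` bases r ` W3_K4_free n r) \<le> 1 + card (rank3_class ({1..n} - T))"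
proof -
  let ?E = "{1..n}" and ?f = "\<lambda>K. (\<lambda>X. X \<union> T) ` {X \<in> K. card X = 3}"
  have finT: "finite T" using assms(1) by (rule finite_subset) simp
  have "bases r I \<inter> {B. T \<subseteq> B} \<in> insert {} (?f ` rank3_class (?E - T))" if I: "I \<in> W3_K4_free n r" for I
  proof (cases "T \<in> I")
    case False
    have "matroid ?E I" using I by (simp add: W3_K4_free_def)
    then have "bases r I \<inter> {B. T \<subseteq> B} = {}" using matroid_subset False by (auto simp: bases_def)
    then show ?thesis by simp
  next
    case True
    have m: "matroid ?E I" and rank: "\<And>X. X \<in> I \<Longrightarrow> card X \<le> r" using I by (auto simp: W3_K4_free_def)
    let ?K = "contract ?E I T"
    have card: "card (X \<union> T) = card X + card T" if "X \<in> ?K" for X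
    proof (rule card_Un_disjoint[OF _ finT])
      show "finite X" using that by (auto simp: contract_def intro: finite_subset)
    qed (use that in \<open>auto simp: contract_def\<close>)
    have K3: "card X \<le> 3" if "X \<in> ?K" for X
      using card[OF that] rank[of "X \<union> T"] that assms(2) by (simp add: contract_def)
    have "?K \<in> rank3_class (?E - T)"
      using I K3 matroid_contract[OF m True] triangle_closed_contract[OF m True K3]
      by (simp add: rank3_class_def W3_K4_free_def)
    moreover have "bases r I \<inter> {B. T \<subseteq> B} = ?f ?K"
    proof (intro equalityI subsetI)
      fix B assume B: "B \<in> bases r I \<inter> {B. T \<subseteq> B}"
      then have "B - T \<in> ?K" "(B - T) \<union> T = B" using m by (auto simp: contract_def bases_def matroid_def Un_absorb2)
      moreover have "card B = r" using B by (simp add: bases_def)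
      ultimately show "B \<in> ?f ?K" using card[of "B - T"] assms(2) by (intro image_eqI[of _ _ "B - T"]) auto
    next
      fix B assume "B \<in> ?f ?K"
      then obtain X where X: "B = X \<union> T" "X \<in> ?K" "card X = 3" by blast
      then show "B \<in> bases r I \<inter> {B. T \<subseteq> B}" using card[OF X(2)] assms(2) by (simp add: bases_def contract_def)
    qed
    ultimately show ?thesis by blast
  qed
  then have "(\<lambda>A. A \<inter> {B. T \<subseteq> B}) ` bases r ` W3_K4_free n r \<subseteq> insert {} (?f ` rank3_class (?E - T))"
    by auto
  then have "card ((\<lambda>A. A \<inter> {B. T \<subseteq> B}) ` bases r ` W3_K4_free n r) \<le> card (insert {} (?f ` rank3_class (?E - T)))"
    by (rule card_mono[rotated]) (simp add: finite_rank3_class)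
  also have "\<dots> \<le> Suc (card (?f ` rank3_class (?E - T)))" by (simp add: card_insert_if finite_rank3_class)
  also have "\<dots> \<le> Suc (card (rank3_class (?E - T)))" using card_image_le[OF finite_rank3_class] by simp
  finally show ?thesis by simp
qed

text \<open>Shearer's inequality over the ground set of all \<open>r\<close>-subsets: each of them
  contains exactly \<open>r choose 3\<close> sets \<open>T\<close> of size \<open>r - 3\<close>, so
  the cover is uniform.\<close>

lemma card_W3_K4_free_power_le:
  fixes b :: real
  assumes "3 \<le> r" "r \<le> n"
    and b: "\<And>T. T \<subseteq> {1..n} \<Longrightarrow> card T + 3 = r \<Longrightarrow> 1 + real (card (rank3_class ({1..n} - T))) \<le> b"
  shows "real (card (W3_K4_free n r)) ^ (r choose 3) \<le> b ^ (n choose (r - 3))"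
proof -
  let ?V = "{B. B \<subseteq> {1..n} \<and> card B = r}" and ?J = "{T. T \<subseteq> {1..n} \<and> card T = r - 3}"
  let ?A = "bases r ` W3_K4_free n r"
  have "real (card ?A) ^ (r choose 3) \<le> (\<Prod>T\<in>?J. real (card ((\<lambda>A. A \<inter> {B. T \<subseteq> B}) ` ?A)))"
  proof (rule shearer_set_family[where V = ?V])
    show "?A \<subseteq> Pow ?V" using bases_subset by blast
    fix B assume B: "B \<in> ?V"
    then have "{T \<in> ?J. B \<in> {B. T \<subseteq> B}} = {T. T \<subseteq> B \<and> card T = r - 3}" by auto
    moreover have "finite B" using B by (auto intro: finite_subset)
    ultimately show "card {T \<in> ?J. B \<in> {B. T \<subseteq> B}} = r choose 3"
      using B assms(1) by (simp add: n_subsets binomial_symmetric[of 3 r])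
  qed (use assms(1) in auto)
  also have "\<dots> \<le> (\<Prod>T\<in>?J. b)"
  proof (intro prod_mono conjI)
    fix T assume T: "T \<in> ?J"
    then have T': "T \<subseteq> {1..n}" "card T + 3 = r" using assms(1) by auto
    have "real (card ((\<lambda>A. A \<inter> {B. T \<subseteq> B}) ` ?A)) \<le> real (1 + card (rank3_class ({1..n} - T)))"
      by (intro of_nat_mono card_traces_le T')
    also have "\<dots> \<le> b" using b[OF T'] by simp
    finally show "real (card ((\<lambda>A. A \<inter> {B. T \<subseteq> B}) ` ?A)) \<le> b" .
  qed simp
  also have "\<dots> = b ^ (n choose (r - 3))" by (simp add: n_subsets)
  finally show ?thesis by (simp add: card_image[OF inj_on_bases])
qed

lemma six_times_choose_three: "6 * ((k + 3) choose 3) = (k + 3) * (k + 2) * (k + 1)"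
proof -
  have "(k + 3) * (k + 2 choose 2) = (k + 3 choose 3) * 3"
    using Suc_times_binomial_eq[of "k + 2" 2] by (simp add: eval_nat_numeral)
  then have "6 * (k + 3 choose 3) = (k + 3) * ((k + 2 choose 2) * 2)" by simp
  also have "(k + 2 choose 2) * 2 = (k + 2) * (k + 1)"
    using Suc_times_binomial_eq[of "k + 1" 1] by (simp add: eval_nat_numeral)
  finally show ?thesis by (simp only: mult.assoc)
qed

text \<open>Double counting of pairs of nested sets trades \<open>r choose 3\<close> for
  \<open>(k + 3) choose 3\<close>, a cubic in \<open>k\<close> against the quadratic exponent. The
  constant 24 is 6 from the binomial, 2 from \<open>k + 3 \<le> 2 * (k + 2)\<close> and 2 from
  Pascal's rule.\<close>

lemma ln_card_W3_K4_free_le: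
  fixes d :: real
  assumes "3 \<le> r" "r \<le> n" "0 \<le> d" "0 < card (W3_K4_free n r)"
    and b: "\<And>T. T \<subseteq> {1..n} \<Longrightarrow> card T + 3 = r \<Longrightarrow>
      1 + real (card (rank3_class ({1..n} - T))) \<le> exp (d * (real (n - r) + 3)\<^sup>2)"
  shows "ln (card (W3_K4_free n r)) \<le> 24 * d * (n choose (n div 2)) / n"
proof -
  define k where "k = n - r"
  define c where "c = ln (card (W3_K4_free n r))"
  have n: "n = k + r" using assms(2) by (simp add: k_def)
  have "ln (real (card (W3_K4_free n r)) ^ (r choose 3)) \<le> ln (exp (d * (k + 3)\<^sup>2) ^ (n choose (r - 3)))"
    using card_W3_K4_free_power_le[OF assms(1,2) b] assms(4) by (simp add: k_def)
  then have "(r choose 3) * c \<le> (n choose (r - 3)) * (d * (k + 3)\<^sup>2)"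
    using assms(4) by (simp add: ln_realpow c_def)
  then have "(n choose r) * ((r choose 3) * c) \<le> (n choose r) * ((n choose (r - 3)) * (d * (k + 3)\<^sup>2))"
    by (rule mult_left_mono) simp
  moreover have "(n choose r) * (r choose 3) = (n choose (r - 3)) * ((k + 3) choose 3)"
    using choose_mult[of "r - 3" r n] assms(1,2) binomial_symmetric[of 3 r] by (simp add: k_def)
  then have "real (n choose r) * (r choose 3) = real (n choose (r - 3)) * ((k + 3) choose 3)"
    by (simp flip: of_nat_mult)
  ultimately have "real (n choose (r - 3)) * (((k + 3) choose 3) * c)
      \<le> real (n choose (r - 3)) * ((n choose r) * (d * (k + 3)\<^sup>2))"
    by (metis (no_types, opaque_lifting) mult.assoc mult.left_commute)
  moreover have "0 < n choose (r - 3)" using assms(2) by simp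
  ultimately have "((k + 3) choose 3) * c \<le> (n choose r) * (d * (k + 3)\<^sup>2)"
    by (simp add: mult_le_cancel_left_pos)
  then have "real (6 * ((k + 3) choose 3)) * c \<le> 6 * (n choose r) * (d * (k + 3)\<^sup>2)" by simp
  then have "real ((k + 3) * (k + 2) * (k + 1)) * c \<le> 6 * (n choose r) * (d * (k + 3)\<^sup>2)"
    by (simp only: six_times_choose_three)
  then have "real (k + 3) * ((k + 2) * (k + 1) * c) \<le> real (k + 3) * (6 * (n choose r) * (d * (k + 3)))"
    by (simp only: power2_eq_square mult_ac of_nat_mult)
  then have "real ((k + 2) * (k + 1)) * c \<le> 6 * (n choose r) * (d * (k + 3))"
    by (simp only: mult_le_cancel_left_pos of_nat_0_less_iff)
  also have "\<dots> \<le> 6 * (n choose r) * (d * (2 * (k + 2)))"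
    using assms(3) by (intro mult_left_mono) auto
  finally have "real (k + 2) * ((k + 1) * c) \<le> real (k + 2) * (12 * d * (n choose r))"
    by (simp add: algebra_simps)
  then have "real (k + 1) * c \<le> 12 * d * (n choose r)"
    by (simp only: mult_le_cancel_left_pos of_nat_0_less_iff)
  \<comment> \<open>Absorbing \<open>k + 1\<close> into a binomial of \<open>n + 1\<close> produces
    the factor \<open>1 / (n + 1)\<close> uniformly in \<open>r\<close>, even where \<open>k\<close>
    is much smaller than \<open>n\<close>.\<close>
  also have "real (n choose r) = (k + 1) / (n + 1) * (Suc n choose r)"
    using of_nat_binomial_eq_mult_binomial_Suc[of r n, where 'a = real] assms(2) by (simp add: k_def)
  finally have "real (k + 1) * c \<le> real (k + 1) * (12 * d * (Suc n choose r) / (n + 1))"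
    by (simp add: mult_ac)
  then have "c \<le> 12 * d * (Suc n choose r) / (n + 1)"
    by (simp only: mult_le_cancel_left_pos of_nat_0_less_iff)
  also have "\<dots> \<le> 12 * d * (2 * (n choose (n div 2))) / n"
  proof (intro frac_le mult_left_mono)
    have "Suc n choose r = (n choose (r - 1)) + (n choose r)"
      using assms(1) by (cases r) auto
    also have "\<dots> \<le> 2 * (n choose (n div 2))"
      using binomial_maximum[of n "r - 1"] binomial_maximum[of n r] by simp
    finally show "real (Suc n choose r) \<le> 2 * (n choose (n div 2))" by linarith
  qed (use assms in auto)
  finally show ?thesis by (simp add: c_def)
qed

section \<open>Asymptotic comparison over all ranks\<close>

lemma power_le_exp2_eventually:
  fixes c :: real
  assumes "0 < c"
  shows "\<forall>\<^sub>F n in sequentially. real n ^ k \<le> c * 2 ^ n"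
proof -
  have "filterlim (\<lambda>n. ln 2 * real n) at_top sequentially"
    by (rule filterlim_tendsto_pos_mult_at_top[OF tendsto_const _ filterlim_real_sequentially]) simp
  then have "(\<lambda>n. (ln 2 * real n) ^ k / exp (ln 2 * real n)) \<longlonglongrightarrow> 0"
    by (rule filterlim_compose[OF tendsto_power_div_exp_0])
  then have "\<forall>\<^sub>F n in sequentially. (ln 2 * real n) ^ k / exp (ln 2 * real n) < c * ln 2 ^ k"
    by (rule order_tendstoD(2)) (use assms in simp)
  then show ?thesis
  proof eventually_elim
    case (elim n)
    have "exp (ln 2 * real n) = 2 ^ n" using exp_of_nat_mult[of n "ln 2 :: real"] by (simp add: mult.commute)
    with elim have "ln 2 ^ k * real n ^ k < ln 2 ^ k * (c * 2 ^ n)"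
      by (simp add: power_mult_distrib divide_less_eq mult_ac)
    then show ?case by (simp add: mult_less_cancel_left_pos)
  qed
qed

lemma two_power_le_central_binomial: "2 ^ n \<le> (n + 1) * (n choose (n div 2))"
proof -
  have "2 ^ n = (\<Sum>k\<le>n. n choose k)" by (rule choose_row_sum[symmetric])
  also have "\<dots> \<le> (\<Sum>k\<le>n. n choose (n div 2))" by (intro sum_mono binomial_maximum)
  finally show ?thesis by simp
qed

lemma card_W3_K4_free_eventually:
  fixes t :: real
  assumes "0 < t"
  shows "\<forall>\<^sub>F n in sequentially. \<forall>r\<le>n. card (W3_K4_free n r) \<le> exp (t * (n choose (n div 2)) / n)"
proof -
  \<comment> \<open>Chosen so that \<open>24 * (2 * d) = t\<close>; the doubling of \<open>d\<close>
    pays for the summand 1 of the empty trace.\<close>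
  define d where "d = t / 48"
  have d: "0 < d" using assms by (simp add: d_def)
  obtain n0 where n0: "\<forall>E. finite E \<longrightarrow> n0 \<le> card E \<longrightarrow> card (rank3_class E) \<le> exp (d * (card E)\<^sup>2)"
    using card_rank3_class[OF d] by blast
  \<comment> \<open>For \<open>n - r\<close> at least \<open>K\<close> the contraction has at least
    \<open>n0\<close> points and \<open>d * N\<close> is at least 1. The final 2 lets the exponent
    \<open>K\<close> also cover the ranks below 3.\<close>
  define K where "K = n0 + nat \<lceil>1 / d\<rceil> + 2"
  have "\<forall>\<^sub>F n in sequentially. real n ^ (K + 2) \<le> t / 2 * 2 ^ n"
    using assms by (intro power_le_exp2_eventually) simp
  then show ?thesis using eventually_gt_at_top[of 0]
  proof eventually_elim
    case (elim n)
    let ?M = "n choose (n div 2)"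
    have small: "card (W3_K4_free n r) \<le> exp (t * ?M / n)" if "n choose r \<le> n ^ K" for r
    proof -
      have "real (card (W3_K4_free n r)) \<le> real (2 ^ (n choose r))"
        by (intro of_nat_mono card_W3_K4_free_le)
      also have "\<dots> \<le> exp 1 ^ (n choose r)" using exp_ge_add_one_self[of 1] by (simp add: power_mono)
      also have "\<dots> = exp (n choose r)" by (simp flip: exp_of_nat_mult)
      also have "\<dots> \<le> exp (t * ?M / n)"
      proof -
        have "real (n choose r) \<le> real n ^ K" using that by (simp flip: of_nat_power)
        then have "real (n choose r) * (real n * (2 * real n)) \<le> real n ^ K * (real n * (2 * real n))"
          by (rule mult_right_mono) simp
        also have "\<dots> \<le> t * 2 ^ n" using elim(1) by (simp add: power_add power2_eq_square mult_ac)
        also have "\<dots> \<le> t * ((n + 1) * ?M)"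
        proof (rule mult_left_mono)
          have "real (2 ^ n) \<le> real ((n + 1) * ?M)" by (intro of_nat_mono two_power_le_central_binomial)
          then show "2 ^ n \<le> real ((n + 1) * ?M)" by simp
        qed (use assms in simp)
        also have "\<dots> \<le> t * (2 * real n * ?M)"
        proof (intro mult_left_mono)
          have "real (n + 1) \<le> 2 * real n" using elim(2) by simp
          then have "real (n + 1) * ?M \<le> 2 * real n * ?M" by (rule mult_right_mono) simp
          then show "real ((n + 1) * ?M) \<le> 2 * real n * ?M" by simp
        qed (use assms in simp)
        finally have "(real (n choose r) * n) * (2 * real n) \<le> (t * ?M) * (2 * real n)" by (simp add: mult_ac)
        then have "real (n choose r) * n \<le> t * ?M" using elim(2) by (simp add: mult_le_cancel_right)
        then show ?thesis using elim(2) by (simp add: field_simps)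
      qed
      finally show ?thesis .
    qed
    show ?case
    proof (intro allI impI)
      fix r assume r: "r \<le> n"
      consider "r < 3" | "n - r < K" | "3 \<le> r" "K \<le> n - r" by linarith
      then show "card (W3_K4_free n r) \<le> exp (t * ?M / n)"
      proof cases
        case 1
        have "n choose r \<le> n ^ r" using r by (rule binomial_le_pow)
        also have "\<dots> \<le> n ^ K" using 1 elim(2) by (intro power_increasing) (auto simp: K_def)
        finally show ?thesis by (rule small)
      next
        case 2
        have "n choose r = n choose (n - r)" using r by (rule binomial_symmetric)
        also have "\<dots> \<le> n ^ (n - r)" by (rule binomial_le_pow) simp
        also have "\<dots> \<le> n ^ K" using 2 elim(2) by (intro power_increasing) auto
        finally show ?thesis by (rule small)
      next
        case 3
        show ?thesis
        proof (cases "card (W3_K4_free n r) = 0")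
          case False
          have "ln (card (W3_K4_free n r)) \<le> 24 * (2 * d) * ?M / n"
          proof (rule ln_card_W3_K4_free_le)
            fix T :: "nat set" assume T: "T \<subseteq> {1..n}" "card T + 3 = r"
            define N where "N = n - r + 3"
            have cardN: "card ({1..n} - T) = N" using T r by (auto simp: card_Diff_subset finite_subset N_def)
            have "1 / d \<le> N" using 3 unfolding K_def N_def by linarith
            then have "1 \<le> d * N" using d by (simp add: field_simps)
            also have "\<dots> \<le> d * N\<^sup>2"
              using d by (intro mult_left_mono of_nat_mono) (auto simp: power2_eq_square)
            finally have dN: "1 \<le> d * N\<^sup>2" .
            have "2 \<le> exp (d * N\<^sup>2)" using exp_ge_add_one_self[of "d * N\<^sup>2"] dN by linarith
            then have "2 * exp (d * N\<^sup>2) \<le> exp (d * N\<^sup>2) * exp (d * N\<^sup>2)" by (rule mult_right_mono) simp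
            moreover have "1 \<le> exp (d * N\<^sup>2)" using dN by simp
            moreover have "card (rank3_class ({1..n} - T)) \<le> exp (d * N\<^sup>2)"
              using n0[rule_format, of "{1..n} - T"] cardN 3 by (simp add: K_def N_def)
            ultimately have "1 + real (card (rank3_class ({1..n} - T))) \<le> exp (d * N\<^sup>2) * exp (d * N\<^sup>2)" by linarith
            also have "\<dots> = exp (2 * d * N\<^sup>2)" by (simp flip: exp_add)
            finally show "1 + real (card (rank3_class ({1..n} - T))) \<le> exp (2 * d * (real (n - r) + 3)\<^sup>2)"
              by (simp add: N_def)
          qed (use 3 r d False in auto)
          also have "\<dots> = t * ?M / n" by (simp add: d_def)
          finally have "exp (ln (card (W3_K4_free n r))) \<le> exp (t * ?M / n)" by simp
          then show ?thesis using False by simp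
        qed simp
      qed
    qed
  qed
qed

lemma m_X_le_sum: "m_X n \<le> (\<Sum>r\<le>n. card (W3_K4_free n r))"
proof -
  let ?C = "{I. matroid {1..n} I \<and>
      \<not> has_minor_iso {1..n} I {0..<6} W3_indep \<and> \<not> has_minor_iso {1..n} I {0..<6} K4_indep}"
  have "?C \<subseteq> (\<Union>r\<le>n. W3_K4_free n r)"
  proof
    fix I assume I: "I \<in> ?C"
    then have "I \<noteq> {}" and sub: "\<And>X. X \<in> I \<Longrightarrow> X \<subseteq> {1..n}" by (auto simp: matroid_def)
    moreover have "finite I" using sub by (intro finite_subset[of I "Pow {1..n}"]) auto
    ultimately have "Max (card ` I) \<in> card ` I" "\<forall>X\<in>I. card X \<le> Max (card ` I)" by auto
    then obtain B where B: "B \<in> I" "\<forall>X\<in>I. card X \<le> card B" by auto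
    have "card B \<le> n" using card_mono[OF _ sub[OF B(1)]] by simp
    then show "I \<in> (\<Union>r\<le>n. W3_K4_free n r)" using I B by (auto simp: W3_K4_free_def)
  qed
  then have "m_X n \<le> card (\<Union>r\<le>n. W3_K4_free n r)"
    unfolding m_X_def by (rule card_mono[rotated]) (simp add: finite_W3_K4_free)
  also have "\<dots> \<le> (\<Sum>r\<le>n. card (W3_K4_free n r))" by (rule card_UN_le) simp
  finally show ?thesis .
qed

theorem theorem13:
  shows "(\<lambda>n. real (m_X n)) \<in> o(\<lambda>n. real (s_sp n))"
proof (rule landau_o.smallI)
  fix c :: real assume c: "0 < c"
  \<comment> \<open>Half of \<open>ln 2\<close>: the square of the bound for a single rank is then
    exactly the lower bound for \<open>s_sp n\<close>, and the spare factor absorbs both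
    \<open>c\<close> and the number of ranks.\<close>
  define t :: real where "t = ln 2 / 2"
  have t: "0 < t" by (simp add: t_def)
  \<comment> \<open>The cube comes from \<open>n + 1\<close> ranks, the denominator \<open>n\<close>
    in the exponent, and the loss of \<open>n + 1\<close> in estimating the central binomial by
    \<open>2 ^ n\<close>.\<close>
  have "\<forall>\<^sub>F n in sequentially. real n ^ 3 \<le> c * t / 4 * 2 ^ n"
    using c t by (intro power_le_exp2_eventually) simp
  then show "\<forall>\<^sub>F n in sequentially. norm (real (m_X n)) \<le> c * norm (real (s_sp n))"
    using card_W3_K4_free_eventually[OF t] eventually_gt_at_top[of 1]
  proof eventually_elim
    case (elim n)
    define y where "y = t * (n choose (n div 2)) / n"
    have n: "0 < real n" "real (n + 1) \<le> 2 * n" using elim(3) by auto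
    have "real (m_X n) \<le> real (\<Sum>r\<le>n. card (W3_K4_free n r))" by (rule of_nat_mono[OF m_X_le_sum])
    also have "\<dots> \<le> (\<Sum>r\<le>n. exp y)" unfolding of_nat_sum by (rule sum_mono) (use elim(2) in \<open>simp add: y_def\<close>)
    also have "\<dots> = real (n + 1) * exp y" by simp
    also have "\<dots> \<le> c * exp y * exp y"
    proof (rule mult_right_mono)
      have "real n * (real (n + 1) * real (n + 1)) \<le> real n * ((2 * real n) * (2 * real n))"
        using n by (intro mult_left_mono mult_mono) auto
      also have "\<dots> = 4 * real n ^ 3" by (simp add: power3_eq_cube)
      also have "\<dots> \<le> c * t * 2 ^ n" using elim(1) by simp
      also have "\<dots> \<le> c * t * real ((n + 1) * (n choose (n div 2)))"
      proof (rule mult_left_mono)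
        have "real (2 ^ n) \<le> real ((n + 1) * (n choose (n div 2)))"
          by (rule of_nat_mono[OF two_power_le_central_binomial])
        then show "2 ^ n \<le> real ((n + 1) * (n choose (n div 2)))" by simp
      qed (use c t in simp)
      finally have "real (n + 1) * (real n * real (n + 1)) \<le> real (n + 1) * (c * t * (n choose (n div 2)))"
        by (simp only: of_nat_mult mult_ac)
      then have "real n * real (n + 1) \<le> c * t * (n choose (n div 2))"
        by (simp only: mult_le_cancel_left_pos of_nat_0_less_iff)
      then have "real (n + 1) \<le> c * y" using n(1) by (simp add: y_def field_simps)
      also have "\<dots> \<le> c * exp y" using c exp_ge_add_one_self[of y] by (intro mult_left_mono) linarith+
      finally show "real (n + 1) \<le> c * exp y" .
    qed simp
    also have "\<dots> = c * 2 powr ((n choose (n div 2)) / n)"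
      by (simp add: powr_def y_def t_def mult.assoc flip: exp_add)
    also have "\<dots> \<le> c * s_sp n"
      using s_sp_ge[of "n div 2" n] elim(3) c by (intro mult_left_mono) auto
    finally show ?case by simp
  qed
qed

end
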